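(* Let $(\mathscr{C},\mathbb{E},\mathfrak{s})$ be a skeletally small Krull–Schmidt extriangulated category with enough projectives and enough injectives satisfying Condition (WIC), and let $\mathcal{T}$ be a subcategory of $\mathscr{C}$ closed under direct summands and finite direct sums. Then the following two definitions of "$\mathcal{T}$ is a tilting subcategory of $\mathscr{C}$" are equivalent. Definition A: $\mathcal{T}$ satisfies (T1) $\mathrm{pd}(\mathcal{T})\leqslant 1$; (T2) $\mathcal{T}$ is a generator of $\mathcal{T}^{\perp_1}$. Definition B: $\mathcal{T}$ satisfies (T1) $\mathrm{pd}(\mathcal{T})\leqslant 1$; (T2$'$) $\mathbb{E}(\mathcal{T},\mathcal{T})=0$, i.e. $\mathbb{E}(T,T')=0$ for all $T,T'\in\mathcal{T}$; (T3) for every projective object $P$ of $\mathscr{C}$ there is a conflation $P\to T_0\to T_1$ with $T_0,T_1\in\mathcal{T}$.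
   Context: Subcategories are full and closed under isomorphisms. $\mathscr{C}(A,B)$ is the set of morphisms $A\to B$; $ba$ means first $a$, then $b$. Extriangulated categories (Nakaoka–Palu). Let $\mathscr{C}$ be an additive category and $\mathbb{E}:\mathscr{C}^{op}\times\mathscr{C}\to Ab$ a biadditive functor. Elements $\delta\in\mathbb{E}(C,A)$ are called $\mathbb{E}$-extensions; for $a:A\to A'$, $c:C'\to C$ put $a_*\delta=\mathbb{E}(C,a)(\delta)$, $c^*\delta=\mathbb{E}(c,A)(\delta)$. A morphism $\delta\to\delta'$ (with $\delta\in\mathbb{E}(C,A)$, $\delta'\in\mathbb{E}(C',A')$) is a pair $(a,c)$, $a:A\to A'$, $c:C\to C'$, with $a_*\delta=c^*\delta'$. Sequences $A\xrightarrow{x}B\xrightarrow{y}C$ and $A\xrightarrow{x'}B'\xrightarrow{y'}C$ are equivalent if there is an isomorphism $b:B\to B'$ with $bx=x'$, $y'b=y$. A realization $\mathfrak{s}$ assigns to each $\delta\in\mathbb{E}(C,A)$ an equivalence class $\mathfrak{s}(\delta)=[A\xrightarrow{x}B\xrightarrow{y}C]$ such that for every morphism $(a,c):\delta\to\delta'$ with $\mathfrak{s}(\delta')=[A'\xrightarrow{x'}B'\xrightarrow{y'}C']$ there is $b:B\to B'$ with $bx=x'a$, $y'b=cy$. It is additive if $\mathfrak{s}(0)=[A\to A\oplus C\to C]$ (canonical inclusion and projection) and $\mathfrak{s}(\delta\oplus\delta')=\mathfrak{s}(\delta)\oplus\mathfrak{s}(\delta')$. The triple $(\mathscr{C},\mathbb{E},\mathfrak{s})$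 is extriangulated if: (ET1) $\mathbb{E}$ is biadditive; (ET2) $\mathfrak{s}$ is an additive realization; (ET3) if $\delta,\delta'$ are realized by $A\xrightarrow{x}B\xrightarrow{y}C$, $A'\xrightarrow{x'}B'\xrightarrow{y'}C'$ and $bx=x'a$, there is $c:C\to C'$ with $(a,c):\delta\to\delta'$ a morphism and $cy=y'b$; (ET3)$^{op}$ the dual of (ET3); (ET4) if $\delta\in\mathbb{E}(D,A)$, $\delta'\in\mathbb{E}(F,B)$ are realized by $A\xrightarrow{f}B\xrightarrow{f'}D$ and $B\xrightarrow{g}C\xrightarrow{g'}F$, there are an object $E$, morphisms $h=gf:A\to C$, $h':C\to E$, $d:D\to E$, $e:E\to F$ with $h'g=df'$, $eh'=g'$, and $\delta''\in\mathbb{E}(E,A)$ realized by $A\xrightarrow{h}C\xrightarrow{h'}E$, such that $D\xrightarrow{d}E\xrightarrow{e}F$ realizes $f'_*\delta'$, $d^*\delta''=\delta$ and $f_*\delta''=e^*\delta'$; (ET4)$^{op}$ the dual of (ET4). A sequence $A\xrightarrow{x}B\xrightarrow{y}C$ realizing some $\delta\in\mathbb{E}(C,A)$ is a conflation; then $x$ is an inflation and $y$ a deflation. $P$ is projective if $\mathscr{C}(P,y)$ is surjective for every deflation $y$; injective objects are defined dually. $\mathscr{C}$ has enough projectives if every object $A$ admits a deflation $P\to A$ with $P$ projective, and enough injectives if every $A$ admits an inflation $A\to I$ with $I$ injective. Condition (WIC): for all $f:X\to Y$, $g:Y\to Z$, if $gf$ is an inflation then so is $f$; if $gf$ is a deflation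 then so is $g$. A projective resolution of $A$ is a sequence $\cdots\to P_1\to P_0\to A$ with all $P_i$ projective, obtained by splicing conflations $K_{1}\to P_0\to A$, $K_{i+1}\to P_i\to K_i$ ($i\geqslant1$). $\mathrm{pd}(A)$ is the minimal length of a projective resolution of $A$ ($+\infty$ if all are of infinite length), and $\mathrm{pd}(\mathcal{T})=\sup\{\mathrm{pd}(T)\mid T\in\mathcal{T}\}$. $\mathcal{T}^{\perp_1}=\{X\in\mathscr{C}\mid \mathbb{E}(T,X)=0 \text{ for all } T\in\mathcal{T}\}$. A subcategory $\mathcal{U}$ is a generator of a subcategory $\mathcal{V}$ if $\mathcal{U}\subseteq\mathcal{V}$ and for every $V\in\mathcal{V}$ there is a conflation $V'\to U\to V$ with $U\in\mathcal{U}$, $V'\in\mathcal{V}$. *)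

theory Defs
  imports "HOL-Algebra.AbelCoset" "HOL-Library.Extended_Nat"
begin

section \<open>Additive categories\<close>

text \<open>
  A category is given by a set of objects, hom-sets indexed by pairs of objects, a composition
  and identities. Each hom-set carries an abelian group structure, written additively and given by
  the additive part of a \<^typ>\<open>'m ring\<close> record; the multiplicative fields of this record are ignored.
  Composition is in the usual order: \<open>b \<cdot> a\<close> means first \<open>a\<close>, then \<open>b\<close>. Hom-sets need not be disjoint,
  since source and target are always given explicitly.
\<close>

record ('o, 'm) cat =
  Ob :: "'o set"
  Hom :: "'o \<Rightarrow> 'o \<Rightarrow> 'm ring"
  Comp :: "'m \<Rightarrow> 'm \<Rightarrow> 'm" (infixl \<open>\<cdot>\<index>\<close> 75)
  Id :: "'o \<Rightarrow> 'm"

abbreviation mor :: "('o, 'm, 'z) cat_scheme \<Rightarrow> 'o \<Rightarrow> 'o \<Rightarrow> 'm set" where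
  "mor \<C> A B \<equiv> carrier (Hom \<C> A B)"

definition isomorphism :: "('o, 'm, 'z) cat_scheme \<Rightarrow> 'o \<Rightarrow> 'o \<Rightarrow> 'm \<Rightarrow> bool" where
  "isomorphism \<C> A B f \<longleftrightarrow>
     f \<in> mor \<C> A B \<and> (\<exists>g \<in> mor \<C> B A. g \<cdot> f = Id \<C> A \<and> f \<cdot> g = Id \<C> B)"
  for \<C> (structure)

definition isomorphic :: "('o, 'm, 'z) cat_scheme \<Rightarrow> 'o \<Rightarrow> 'o \<Rightarrow> bool" where
  "isomorphic \<C> A B \<longleftrightarrow> (\<exists>f. isomorphism \<C> A B f)"

definition zero_object :: "('o, 'm, 'z) cat_scheme \<Rightarrow> 'o \<Rightarrow> bool" where
  "zero_object \<C> Z \<longleftrightarrow> Z \<in> Ob \<C> \<and>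
     (\<forall>A \<in> Ob \<C>. mor \<C> A Z = {\<zero>\<^bsub>Hom \<C> A Z\<^esub>} \<and> mor \<C> Z A = {\<zero>\<^bsub>Hom \<C> Z A\<^esub>})"

text \<open>\<open>S\<close> is the direct sum \<open>A \<oplus> B\<close>, with inclusions \<open>i\<^sub>A\<close>, \<open>i\<^sub>B\<close> and projections \<open>p\<^sub>A\<close>, \<open>p\<^sub>B\<close>.\<close>

definition biproduct ::
  "('o, 'm, 'z) cat_scheme \<Rightarrow> 'o \<Rightarrow> 'o \<Rightarrow> 'o \<Rightarrow> 'm \<Rightarrow> 'm \<Rightarrow> 'm \<Rightarrow> 'm \<Rightarrow> bool" where
  "biproduct \<C> A B S i\<^sub>A i\<^sub>B p\<^sub>A p\<^sub>B \<longleftrightarrow>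
     A \<in> Ob \<C> \<and> B \<in> Ob \<C> \<and> S \<in> Ob \<C> \<and>
     i\<^sub>A \<in> mor \<C> A S \<and> i\<^sub>B \<in> mor \<C> B S \<and> p\<^sub>A \<in> mor \<C> S A \<and> p\<^sub>B \<in> mor \<C> S B \<and>
     p\<^sub>A \<cdot> i\<^sub>A = Id \<C> A \<and> p\<^sub>B \<cdot> i\<^sub>B = Id \<C> B \<and>
     p\<^sub>B \<cdot> i\<^sub>A = \<zero>\<^bsub>Hom \<C> A B\<^esub> \<and> p\<^sub>A \<cdot> i\<^sub>B = \<zero>\<^bsub>Hom \<C> B A\<^esub> \<and>
     (i\<^sub>A \<cdot> p\<^sub>A) \<oplus>\<^bsub>Hom \<C> S S\<^esub> (i\<^sub>B \<cdot> p\<^sub>B) = Id \<C> S"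
  for \<C> (structure)

text \<open>\<open>S\<close> is the direct sum of \<open>X 0, \<dots>, X (n - 1)\<close>; for \<open>n = 0\<close> this says that \<open>S\<close> is a zero object.\<close>

definition direct_sum ::
  "('o, 'm, 'z) cat_scheme \<Rightarrow> nat \<Rightarrow> (nat \<Rightarrow> 'o) \<Rightarrow> 'o \<Rightarrow> (nat \<Rightarrow> 'm) \<Rightarrow> (nat \<Rightarrow> 'm) \<Rightarrow> bool" where
  "direct_sum \<C> n X S i p \<longleftrightarrow>
     S \<in> Ob \<C> \<and>
     (\<forall>k<n. X k \<in> Ob \<C> \<and> i k \<in> mor \<C> (X k) S \<and> p k \<in> mor \<C> S (X k)) \<and>
     (\<forall>k<n. \<forall>l<n. p l \<cdot> i k = (if k = l then Id \<C> (X k) else \<zero>\<^bsub>Hom \<C> (X k) (X l)\<^esub>)) \<and>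
     (\<Oplus>\<^bsub>Hom \<C> S S\<^esub>k\<in>{..<n}. i k \<cdot> p k) = Id \<C> S"
  for \<C> (structure)

locale additive_category =
  fixes \<C> :: "('o, 'm, 'z) cat_scheme" (structure)
  assumes Hom_abelian_group: "\<lbrakk>A \<in> Ob \<C>; B \<in> Ob \<C>\<rbrakk> \<Longrightarrow> abelian_group (Hom \<C> A B)"
    and Comp_closed:
      "\<lbrakk>A \<in> Ob \<C>; B \<in> Ob \<C>; C \<in> Ob \<C>; f \<in> mor \<C> A B; g \<in> mor \<C> B C\<rbrakk> \<Longrightarrow> g \<cdot> f \<in> mor \<C> A C"
    and Comp_assoc:
      "\<lbrakk>A \<in> Ob \<C>; B \<in> Ob \<C>; C \<in> Ob \<C>; D \<in> Ob \<C>;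
        f \<in> mor \<C> A B; g \<in> mor \<C> B C; h \<in> mor \<C> C D\<rbrakk> \<Longrightarrow> (h \<cdot> g) \<cdot> f = h \<cdot> (g \<cdot> f)"
    and Id_closed: "A \<in> Ob \<C> \<Longrightarrow> Id \<C> A \<in> mor \<C> A A"
    and Comp_Id_left: "\<lbrakk>A \<in> Ob \<C>; B \<in> Ob \<C>; f \<in> mor \<C> A B\<rbrakk> \<Longrightarrow> Id \<C> B \<cdot> f = f"
    and Comp_Id_right: "\<lbrakk>A \<in> Ob \<C>; B \<in> Ob \<C>; f \<in> mor \<C> A B\<rbrakk> \<Longrightarrow> f \<cdot> Id \<C> A = f"
    and Comp_add_left:
      "\<lbrakk>A \<in> Ob \<C>; B \<in> Ob \<C>; C \<in> Ob \<C>; f \<in> mor \<C> A B; g \<in> mor \<C> B C; g' \<in> mor \<C> B C\<rbrakk>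
       \<Longrightarrow> (g \<oplus>\<^bsub>Hom \<C> B C\<^esub> g') \<cdot> f = (g \<cdot> f) \<oplus>\<^bsub>Hom \<C> A C\<^esub> (g' \<cdot> f)"
    and Comp_add_right:
      "\<lbrakk>A \<in> Ob \<C>; B \<in> Ob \<C>; C \<in> Ob \<C>; f \<in> mor \<C> A B; f' \<in> mor \<C> A B; g \<in> mor \<C> B C\<rbrakk>
       \<Longrightarrow> g \<cdot> (f \<oplus>\<^bsub>Hom \<C> A B\<^esub> f') = (g \<cdot> f) \<oplus>\<^bsub>Hom \<C> A C\<^esub> (g \<cdot> f')"
    and zero_object_exists: "\<exists>Z. zero_object \<C> Z"
    and biproduct_exists:
      "\<lbrakk>A \<in> Ob \<C>; B \<in> Ob \<C>\<rbrakk> \<Longrightarrow> \<exists>S i\<^sub>A i\<^sub>B p\<^sub>A p\<^sub>B. biproduct \<C> A B S i\<^sub>A i\<^sub>B p\<^sub>A p\<^sub>B"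


section \<open>Skeletally small and Krull--Schmidt categories\<close>

text \<open>
  The isomorphism classes of objects have a set of representatives. Since the objects of a
  category in the sense above already form a set of elements of a HOL type, every such category
  satisfies this condition (take \<open>R = Ob \<C>\<close>): smallness carries no restriction in HOL.
\<close>

definition skeletally_small :: "('o, 'm, 'z) cat_scheme \<Rightarrow> bool" where
  "skeletally_small \<C> \<longleftrightarrow> (\<exists>R \<subseteq> Ob \<C>. \<forall>A \<in> Ob \<C>. \<exists>B \<in> R. isomorphic \<C> A B)"

definition End_ring :: "('o, 'm, 'z) cat_scheme \<Rightarrow> 'o \<Rightarrow> 'm ring" where
  "End_ring \<C> A = (Hom \<C> A A)\<lparr>mult := Comp \<C>, one := Id \<C> A\<rparr>"

text \<open>A (noncommutative) ring is local if it is nonzero and its non-units are closed under addition.\<close>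

definition local_ring :: "('a, 'b) ring_scheme \<Rightarrow> bool" where
  "local_ring R \<longleftrightarrow> ring R \<and> \<one>\<^bsub>R\<^esub> \<noteq> \<zero>\<^bsub>R\<^esub> \<and>
     (\<forall>a \<in> carrier R - Units R. \<forall>b \<in> carrier R - Units R. a \<oplus>\<^bsub>R\<^esub> b \<notin> Units R)"

definition krull_schmidt :: "('o, 'm, 'z) cat_scheme \<Rightarrow> bool" where
  "krull_schmidt \<C> \<longleftrightarrow>
     (\<forall>A \<in> Ob \<C>. \<exists>n X i p. direct_sum \<C> n X A i p \<and> (\<forall>k<n. local_ring (End_ring \<C> (X k))))"


section \<open>Extriangulated categories\<close>

text \<open>
  \<open>Ext \<C> C A\<close> is the abelian group \<open>\<E>(C, A)\<close>, and \<open>ExtM \<C> c a : \<E>(C, A) \<rightarrow> \<E>(C', A')\<close> is \<open>\<E>(c, a)\<close>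
  for \<open>c : C' \<rightarrow> C\<close> and \<open>a : A \<rightarrow> A'\<close>. For \<open>\<delta> \<in> \<E>(C, A)\<close>, the class \<open>\<s>(\<delta>)\<close> is \<open>Real \<C> C A \<delta>\<close>; a sequence
  \<open>A \<rightarrow> B \<rightarrow> C\<close> with maps \<open>x\<close> and \<open>y\<close> is encoded as the triple \<open>(x, B, y)\<close>.
\<close>

record ('o, 'm, 'e) extri = "('o, 'm) cat" +
  Ext :: "'o \<Rightarrow> 'o \<Rightarrow> 'e ring"
  ExtM :: "'m \<Rightarrow> 'm \<Rightarrow> 'e \<Rightarrow> 'e"
  Real :: "'o \<Rightarrow> 'o \<Rightarrow> 'e \<Rightarrow> ('m \<times> 'o \<times> 'm) set"

abbreviation ext :: "('o, 'm, 'e, 'z) extri_scheme \<Rightarrow> 'o \<Rightarrow> 'o \<Rightarrow> 'e set" where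
  "ext \<C> C A \<equiv> carrier (Ext \<C> C A)"

text \<open>\<open>push \<C> C a \<delta> = a\<^sub>* \<delta>\<close> for \<open>\<delta> \<in> \<E>(C, A)\<close>, and \<open>pull \<C> A c \<delta> = c\<^sup>* \<delta>\<close> for \<open>\<delta> \<in> \<E>(C, A)\<close>.\<close>

definition push :: "('o, 'm, 'e, 'z) extri_scheme \<Rightarrow> 'o \<Rightarrow> 'm \<Rightarrow> 'e \<Rightarrow> 'e" where
  "push \<C> C a \<delta> = ExtM \<C> (Id \<C> C) a \<delta>"

definition pull :: "('o, 'm, 'e, 'z) extri_scheme \<Rightarrow> 'o \<Rightarrow> 'm \<Rightarrow> 'e \<Rightarrow> 'e" where
  "pull \<C> A c \<delta> = ExtM \<C> c (Id \<C> A) \<delta>"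

definition seqs :: "('o, 'm, 'z) cat_scheme \<Rightarrow> 'o \<Rightarrow> 'o \<Rightarrow> ('m \<times> 'o \<times> 'm) set" where
  "seqs \<C> A C = {(x, B, y). B \<in> Ob \<C> \<and> x \<in> mor \<C> A B \<and> y \<in> mor \<C> B C}"

definition seq_equiv ::
  "('o, 'm, 'z) cat_scheme \<Rightarrow> 'o \<Rightarrow> 'o \<Rightarrow> (('m \<times> 'o \<times> 'm) \<times> ('m \<times> 'o \<times> 'm)) set" where
  "seq_equiv \<C> A C =
     {((x, B, y), (x', B', y')).
        (x, B, y) \<in> seqs \<C> A C \<and> (x', B', y') \<in> seqs \<C> A C \<and>
        (\<exists>b. isomorphism \<C> B B' b \<and> b \<cdot> x = x' \<and> y' \<cdot> b = y)}"
  for \<C> (structure)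

text \<open>\<open>(a, c)\<close> is a morphism of extensions from \<open>\<delta> \<in> \<E>(C, A)\<close> to \<open>\<delta>' \<in> \<E>(C', A')\<close>.\<close>

definition ext_morphism ::
  "('o, 'm, 'e, 'z) extri_scheme \<Rightarrow> 'o \<Rightarrow> 'o \<Rightarrow> 'e \<Rightarrow> 'o \<Rightarrow> 'o \<Rightarrow> 'e \<Rightarrow> 'm \<Rightarrow> 'm \<Rightarrow> bool" where
  "ext_morphism \<C> C A \<delta> C' A' \<delta>' a c \<longleftrightarrow>
     a \<in> mor \<C> A A' \<and> c \<in> mor \<C> C C' \<and> push \<C> C a \<delta> = pull \<C> A' c \<delta>'"

text \<open>The sequence \<open>A \<rightarrow> B \<rightarrow> C\<close> with maps \<open>x\<close> and \<open>y\<close> realizes \<open>\<delta> \<in> \<E>(C, A)\<close>.\<close>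

definition realizes ::
  "('o, 'm, 'e, 'z) extri_scheme \<Rightarrow> 'e \<Rightarrow> 'o \<Rightarrow> 'm \<Rightarrow> 'o \<Rightarrow> 'm \<Rightarrow> 'o \<Rightarrow> bool" where
  "realizes \<C> \<delta> A x B y C \<longleftrightarrow>
     A \<in> Ob \<C> \<and> C \<in> Ob \<C> \<and> \<delta> \<in> ext \<C> C A \<and> (x, B, y) \<in> Real \<C> C A \<delta>"

text \<open>(ET1): \<open>\<E> : \<C>\<^sup>o\<^sup>p \<times> \<C> \<rightarrow> Ab\<close> is a biadditive functor.\<close>

locale ET1 = additive_category \<C>
  for \<C> :: "('o, 'm, 'e, 'z) extri_scheme" (structure) +
  assumes Ext_abelian_group: "\<lbrakk>C \<in> Ob \<C>; A \<in> Ob \<C>\<rbrakk> \<Longrightarrow> abelian_group (Ext \<C> C A)"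
    and ExtM_hom:
      "\<lbrakk>C \<in> Ob \<C>; C' \<in> Ob \<C>; A \<in> Ob \<C>; A' \<in> Ob \<C>; c \<in> mor \<C> C' C; a \<in> mor \<C> A A'\<rbrakk>
       \<Longrightarrow> ExtM \<C> c a \<in> hom (add_monoid (Ext \<C> C A)) (add_monoid (Ext \<C> C' A'))"
    and ExtM_Id:
      "\<lbrakk>C \<in> Ob \<C>; A \<in> Ob \<C>; \<delta> \<in> ext \<C> C A\<rbrakk> \<Longrightarrow> ExtM \<C> (Id \<C> C) (Id \<C> A) \<delta> = \<delta>"
    and ExtM_Comp:
      "\<lbrakk>C \<in> Ob \<C>; C' \<in> Ob \<C>; C'' \<in> Ob \<C>; A \<in> Ob \<C>; A' \<in> Ob \<C>; A'' \<in> Ob \<C>;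
        c \<in> mor \<C> C' C; c' \<in> mor \<C> C'' C'; a \<in> mor \<C> A A'; a' \<in> mor \<C> A' A''; \<delta> \<in> ext \<C> C A\<rbrakk>
       \<Longrightarrow> ExtM \<C> (c \<cdot> c') (a' \<cdot> a) \<delta> = ExtM \<C> c' a' (ExtM \<C> c a \<delta>)"
    and ExtM_add_left:
      "\<lbrakk>C \<in> Ob \<C>; C' \<in> Ob \<C>; A \<in> Ob \<C>; A' \<in> Ob \<C>;
        c \<in> mor \<C> C' C; d \<in> mor \<C> C' C; a \<in> mor \<C> A A'; \<delta> \<in> ext \<C> C A\<rbrakk>
       \<Longrightarrow> ExtM \<C> (c \<oplus>\<^bsub>Hom \<C> C' C\<^esub> d) a \<delta> = ExtM \<C> c a \<delta> \<oplus>\<^bsub>Ext \<C> C' A'\<^esub> ExtM \<C> d a \<delta>"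
    and ExtM_add_right:
      "\<lbrakk>C \<in> Ob \<C>; C' \<in> Ob \<C>; A \<in> Ob \<C>; A' \<in> Ob \<C>;
        c \<in> mor \<C> C' C; a \<in> mor \<C> A A'; b \<in> mor \<C> A A'; \<delta> \<in> ext \<C> C A\<rbrakk>
       \<Longrightarrow> ExtM \<C> c (a \<oplus>\<^bsub>Hom \<C> A A'\<^esub> b) \<delta> = ExtM \<C> c a \<delta> \<oplus>\<^bsub>Ext \<C> C' A'\<^esub> ExtM \<C> c b \<delta>"

text \<open>
  (ET2): an additive realization. In \<open>Real_sum\<close>, the extension \<open>\<delta> \<oplus> \<delta>'\<close> is
  \<open>\<E>(p\<^sub>C, i\<^sub>A)(\<delta>) + \<E>(p\<^sub>C', i\<^sub>A')(\<delta>')\<close>, that is, the element of \<open>\<E>(C \<oplus> C', A \<oplus> A')\<close> corresponding to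
  \<open>(\<delta>, 0, 0, \<delta>')\<close> in \<open>\<E>(C, A) \<oplus> \<E>(C, A') \<oplus> \<E>(C', A) \<oplus> \<E>(C', A')\<close>.
\<close>

locale ET2 = ET1 +
  assumes Real_class:
      "\<lbrakk>C \<in> Ob \<C>; A \<in> Ob \<C>; \<delta> \<in> ext \<C> C A\<rbrakk> \<Longrightarrow> Real \<C> C A \<delta> \<in> seqs \<C> A C // seq_equiv \<C> A C"
    and Real_morphism:
      "\<lbrakk>realizes \<C> \<delta> A x B y C; realizes \<C> \<delta>' A' x' B' y' C'; ext_morphism \<C> C A \<delta> C' A' \<delta>' a c\<rbrakk>
       \<Longrightarrow> \<exists>b \<in> mor \<C> B B'. b \<cdot> x = x' \<cdot> a \<and> y' \<cdot> b = c \<cdot> y"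
    and Real_zero:
      "biproduct \<C> A C S i\<^sub>A i\<^sub>C p\<^sub>A p\<^sub>C \<Longrightarrow> realizes \<C> \<zero>\<^bsub>Ext \<C> C A\<^esub> A i\<^sub>A S p\<^sub>C C"
    and Real_sum:
      "\<lbrakk>realizes \<C> \<delta> A x B y C; realizes \<C> \<delta>' A' x' B' y' C';
        biproduct \<C> A A' SA i\<^sub>A i\<^sub>A' p\<^sub>A p\<^sub>A'; biproduct \<C> B B' SB i\<^sub>B i\<^sub>B' p\<^sub>B p\<^sub>B';
        biproduct \<C> C C' SC i\<^sub>C i\<^sub>C' p\<^sub>C p\<^sub>C'\<rbrakk>
       \<Longrightarrow> realizes \<C> (ExtM \<C> p\<^sub>C i\<^sub>A \<delta> \<oplus>\<^bsub>Ext \<C> SC SA\<^esub> ExtM \<C> p\<^sub>C' i\<^sub>A' \<delta>')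
             SA ((i\<^sub>B \<cdot> x \<cdot> p\<^sub>A) \<oplus>\<^bsub>Hom \<C> SA SB\<^esub> (i\<^sub>B' \<cdot> x' \<cdot> p\<^sub>A'))
             SB ((i\<^sub>C \<cdot> y \<cdot> p\<^sub>B) \<oplus>\<^bsub>Hom \<C> SB SC\<^esub> (i\<^sub>C' \<cdot> y' \<cdot> p\<^sub>B')) SC"

locale extriangulated_category = ET2 +
  assumes ET3:
      "\<lbrakk>realizes \<C> \<delta> A x B y C; realizes \<C> \<delta>' A' x' B' y' C';
        a \<in> mor \<C> A A'; b \<in> mor \<C> B B'; b \<cdot> x = x' \<cdot> a\<rbrakk>
       \<Longrightarrow> \<exists>c. ext_morphism \<C> C A \<delta> C' A' \<delta>' a c \<and> c \<cdot> y = y' \<cdot> b"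
    and ET3_op:
      "\<lbrakk>realizes \<C> \<delta> A x B y C; realizes \<C> \<delta>' A' x' B' y' C';
        b \<in> mor \<C> B B'; c \<in> mor \<C> C C'; c \<cdot> y = y' \<cdot> b\<rbrakk>
       \<Longrightarrow> \<exists>a. ext_morphism \<C> C A \<delta> C' A' \<delta>' a c \<and> b \<cdot> x = x' \<cdot> a"
    and ET4:
      "\<lbrakk>realizes \<C> \<delta> A f B f' D; realizes \<C> \<delta>' B g C g' F\<rbrakk>
       \<Longrightarrow> \<exists>E h h' d e \<delta>''.
             E \<in> Ob \<C> \<and> h = g \<cdot> f \<and> h' \<in> mor \<C> C E \<and> d \<in> mor \<C> D E \<and> e \<in> mor \<C> E F \<and>
             h' \<cdot> g = d \<cdot> f' \<and> e \<cdot> h' = g' \<and>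
             realizes \<C> \<delta>'' A h C h' E \<and>
             realizes \<C> (push \<C> F f' \<delta>') D d E e F \<and>
             pull \<C> A d \<delta>'' = \<delta> \<and> push \<C> E f \<delta>'' = pull \<C> B e \<delta>'"
    and ET4_op:
      "\<lbrakk>realizes \<C> \<delta> D f' B f A; realizes \<C> \<delta>' F g' C g B\<rbrakk>
       \<Longrightarrow> \<exists>E h h' d e \<delta>''.
             E \<in> Ob \<C> \<and> h = f \<cdot> g \<and> h' \<in> mor \<C> E C \<and> d \<in> mor \<C> E D \<and> e \<in> mor \<C> F E \<and>
             g \<cdot> h' = f' \<cdot> d \<and> h' \<cdot> e = g' \<and>
             realizes \<C> \<delta>'' E h' C h A \<and>
             realizes \<C> (pull \<C> F f' \<delta>') F e E d D \<and>
             push \<C> A d \<delta>'' = \<delta> \<and> pull \<C> E f \<delta>'' = push \<C> B e \<delta>'"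

definition conflation ::
  "('o, 'm, 'e, 'z) extri_scheme \<Rightarrow> 'o \<Rightarrow> 'm \<Rightarrow> 'o \<Rightarrow> 'm \<Rightarrow> 'o \<Rightarrow> bool" where
  "conflation \<C> A x B y C \<longleftrightarrow> (\<exists>\<delta>. realizes \<C> \<delta> A x B y C)"

definition inflation :: "('o, 'm, 'e, 'z) extri_scheme \<Rightarrow> 'o \<Rightarrow> 'o \<Rightarrow> 'm \<Rightarrow> bool" where
  "inflation \<C> A B x \<longleftrightarrow> (\<exists>y C. conflation \<C> A x B y C)"

definition deflation :: "('o, 'm, 'e, 'z) extri_scheme \<Rightarrow> 'o \<Rightarrow> 'o \<Rightarrow> 'm \<Rightarrow> bool" where
  "deflation \<C> B C y \<longleftrightarrow> (\<exists>A x. conflation \<C> A x B y C)"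

definition projective :: "('o, 'm, 'e, 'z) extri_scheme \<Rightarrow> 'o \<Rightarrow> bool" where
  "projective \<C> P \<longleftrightarrow> P \<in> Ob \<C> \<and>
     (\<forall>B C y. deflation \<C> B C y \<longrightarrow> (\<forall>f \<in> mor \<C> P C. \<exists>g \<in> mor \<C> P B. y \<cdot> g = f))"
  for \<C> (structure)

definition injective :: "('o, 'm, 'e, 'z) extri_scheme \<Rightarrow> 'o \<Rightarrow> bool" where
  "injective \<C> I \<longleftrightarrow> I \<in> Ob \<C> \<and>
     (\<forall>A B x. inflation \<C> A B x \<longrightarrow> (\<forall>f \<in> mor \<C> A I. \<exists>g \<in> mor \<C> B I. g \<cdot> x = f))"
  for \<C> (structure)

definition enough_projectives :: "('o, 'm, 'e, 'z) extri_scheme \<Rightarrow> bool" where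
  "enough_projectives \<C> \<longleftrightarrow> (\<forall>A \<in> Ob \<C>. \<exists>P p. projective \<C> P \<and> deflation \<C> P A p)"

definition enough_injectives :: "('o, 'm, 'e, 'z) extri_scheme \<Rightarrow> bool" where
  "enough_injectives \<C> \<longleftrightarrow> (\<forall>A \<in> Ob \<C>. \<exists>I i. injective \<C> I \<and> inflation \<C> A I i)"

definition WIC :: "('o, 'm, 'e, 'z) extri_scheme \<Rightarrow> bool" where
  "WIC \<C> \<longleftrightarrow>
     (\<forall>X \<in> Ob \<C>. \<forall>Y \<in> Ob \<C>. \<forall>Z \<in> Ob \<C>. \<forall>f \<in> mor \<C> X Y. \<forall>g \<in> mor \<C> Y Z.
        (inflation \<C> X Z (g \<cdot> f) \<longrightarrow> inflation \<C> X Y f) \<and>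
        (deflation \<C> X Z (g \<cdot> f) \<longrightarrow> deflation \<C> Y Z g))"
  for \<C> (structure)


section \<open>Projective dimension\<close>

text \<open>The resolution \<open>\<dots> \<rightarrow> P 1 \<rightarrow> P 0 \<rightarrow> A\<close> is spliced from the conflations \<open>K (i + 1) \<rightarrow> P i \<rightarrow> K i\<close>.\<close>

definition projective_resolution ::
  "('o, 'm, 'e, 'z) extri_scheme \<Rightarrow> 'o \<Rightarrow>
     (nat \<Rightarrow> 'o) \<Rightarrow> (nat \<Rightarrow> 'o) \<Rightarrow> (nat \<Rightarrow> 'm) \<Rightarrow> (nat \<Rightarrow> 'm) \<Rightarrow> bool" where
  "projective_resolution \<C> A P K x y \<longleftrightarrow>
     K 0 = A \<and> (\<forall>i. projective \<C> (P i) \<and> conflation \<C> (K (Suc i)) (x i) (P i) (y i) (K i))"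

text \<open>
  The least \<open>n\<close> such that the resolution is \<open>0 \<rightarrow> P n \<rightarrow> \<dots> \<rightarrow> P 0 \<rightarrow> A\<close>, and \<open>\<infinity>\<close> if there is none.
  Termination at \<open>n\<close> has to include \<open>K i = 0\<close> for \<open>i > n\<close> (so that \<open>P n \<cong> K n\<close>): in an extriangulated
  category \<open>K' \<rightarrow> 0 \<rightarrow> K\<close> can be a conflation with \<open>K \<noteq> 0\<close>, for instance in a triangulated category.
\<close>

definition resolution_length ::
  "('o, 'm, 'z) cat_scheme \<Rightarrow> (nat \<Rightarrow> 'o) \<Rightarrow> (nat \<Rightarrow> 'o) \<Rightarrow> enat" where
  "resolution_length \<C> P K =
     Inf {enat n | n. \<forall>i>n. zero_object \<C> (P i) \<and> zero_object \<C> (K i)}"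

definition pd :: "('o, 'm, 'e, 'z) extri_scheme \<Rightarrow> 'o \<Rightarrow> enat" where
  "pd \<C> A = Inf {resolution_length \<C> P K | P K x y. projective_resolution \<C> A P K x y}"

definition pd_sub :: "('o, 'm, 'e, 'z) extri_scheme \<Rightarrow> 'o set \<Rightarrow> enat" where
  "pd_sub \<C> \<T> = (SUP T\<in>\<T>. pd \<C> T)"


section \<open>Subcategories and tilting\<close>

text \<open>A subcategory is full and closed under isomorphisms, hence given by its set of objects.\<close>

definition subcategory :: "('o, 'm, 'z) cat_scheme \<Rightarrow> 'o set \<Rightarrow> bool" where
  "subcategory \<C> \<T> \<longleftrightarrow>
     \<T> \<subseteq> Ob \<C> \<and> (\<forall>A \<in> \<T>. \<forall>B \<in> Ob \<C>. isomorphic \<C> A B \<longrightarrow> B \<in> \<T>)"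

definition closed_under_summands :: "('o, 'm, 'z) cat_scheme \<Rightarrow> 'o set \<Rightarrow> bool" where
  "closed_under_summands \<C> \<T> \<longleftrightarrow>
     (\<forall>A B S i\<^sub>A i\<^sub>B p\<^sub>A p\<^sub>B. biproduct \<C> A B S i\<^sub>A i\<^sub>B p\<^sub>A p\<^sub>B \<longrightarrow> S \<in> \<T> \<longrightarrow> A \<in> \<T> \<and> B \<in> \<T>)"

definition closed_under_finite_sums :: "('o, 'm, 'z) cat_scheme \<Rightarrow> 'o set \<Rightarrow> bool" where
  "closed_under_finite_sums \<C> \<T> \<longleftrightarrow>
     (\<forall>n X S i p. direct_sum \<C> n X S i p \<longrightarrow> (\<forall>k<n. X k \<in> \<T>) \<longrightarrow> S \<in> \<T>)"

definition perp1 :: "('o, 'm, 'e, 'z) extri_scheme \<Rightarrow> 'o set \<Rightarrow> 'o set" where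
  "perp1 \<C> \<T> = {X \<in> Ob \<C>. \<forall>T \<in> \<T>. ext \<C> T X = {\<zero>\<^bsub>Ext \<C> T X\<^esub>}}"

definition generator :: "('o, 'm, 'e, 'z) extri_scheme \<Rightarrow> 'o set \<Rightarrow> 'o set \<Rightarrow> bool" where
  "generator \<C> \<U> \<V> \<longleftrightarrow>
     \<U> \<subseteq> \<V> \<and> (\<forall>V \<in> \<V>. \<exists>V' \<in> \<V>. \<exists>U \<in> \<U>. \<exists>x y. conflation \<C> V' x U y V)"

definition tilting_A :: "('o, 'm, 'e, 'z) extri_scheme \<Rightarrow> 'o set \<Rightarrow> bool" where
  "tilting_A \<C> \<T> \<longleftrightarrow> pd_sub \<C> \<T> \<le> 1 \<and> generator \<C> \<T> (perp1 \<C> \<T>)"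

definition tilting_B :: "('o, 'm, 'e, 'z) extri_scheme \<Rightarrow> 'o set \<Rightarrow> bool" where
  "tilting_B \<C> \<T> \<longleftrightarrow>
     pd_sub \<C> \<T> \<le> 1 \<and>
     (\<forall>T \<in> \<T>. \<forall>T' \<in> \<T>. ext \<C> T T' = {\<zero>\<^bsub>Ext \<C> T T'\<^esub>}) \<and>
     (\<forall>P. projective \<C> P \<longrightarrow> (\<exists>T\<^sub>0 \<in> \<T>. \<exists>T\<^sub>1 \<in> \<T>. \<exists>x y. conflation \<C> P x T\<^sub>0 y T\<^sub>1))"

end

theory Submission
  imports Defs
begin

text \<open>
  Write \<open>\<T>\<^sup>\<bottom>\<close> for \<^term>\<open>perp1 \<C> \<T>\<close>. Two closure properties of \<open>\<T>\<^sup>\<bottom>\<close> carry both implications. It is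
  closed under extensions, because \<open>\<E>(T, A) \<rightarrow> \<E>(T, B) \<rightarrow> \<E>(T, C)\<close> is exact for every conflation
  \<open>A \<rightarrow> B \<rightarrow> C\<close> (\<open>push_kernel\<close>, \<open>perp1_extension\<close>). And if \<open>pd \<T> \<le> 1\<close>, then \<open>B \<in> \<T>\<^sup>\<bottom>\<close> implies \<open>C \<in> \<T>\<^sup>\<bottom>\<close>
  (\<open>perp1_quotient\<close>): this replaces the vanishing of a second extension functor. The second tool is that two
  conflations with a common first or last term can be completed to a 3-by-3 diagram
  (\<open>pushout_of_inflations\<close>, \<open>pullback_of_deflations\<close>).

  From \<^const>\<open>tilting_A\<close> to \<^const>\<open>tilting_B\<close> (\<open>projective_coresolution\<close>). Let \<open>P\<close> be projective and embed it in an injective object,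
  \<open>P \<rightarrow> I \<rightarrow> C\<close>. Then \<open>I\<close>, and hence its quotient \<open>C\<close>, lie in \<open>\<T>\<^sup>\<bottom>\<close>, so there is a conflation
  \<open>V \<rightarrow> T\<^sub>C \<rightarrow> C\<close> with \<open>V \<in> \<T>\<^sup>\<bottom>\<close> and \<open>T\<^sub>C \<in> \<T>\<close>. The pullback \<open>M\<close> of \<open>I \<rightarrow> C \<leftarrow> T\<^sub>C\<close> sits in \<open>V \<rightarrow> M \<rightarrow> I\<close>,
  so \<open>M \<in> \<T>\<^sup>\<bottom>\<close>, and in \<open>P \<rightarrow> M \<rightarrow> T\<^sub>C\<close>, so \<open>\<E>(M, X) = 0\<close> for all \<open>X \<in> \<T>\<^sup>\<bottom>\<close>. Covering \<open>M\<close> by an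
  object of \<open>\<T>\<close> with kernel in \<open>\<T>\<^sup>\<bottom>\<close> therefore splits, which gives \<open>M \<in> \<T>\<close>, and \<open>P \<rightarrow> M \<rightarrow> T\<^sub>C\<close> is the
  required conflation.

  From \<^const>\<open>tilting_B\<close> to \<^const>\<open>tilting_A\<close> (\<open>perp1_generated\<close>). Let \<open>V \<in> \<T>\<^sup>\<bottom>\<close>, and take \<open>K \<rightarrow> P \<rightarrow> V\<close> with \<open>P\<close> projective and
  \<open>P \<rightarrow> T\<^sub>0 \<rightarrow> T\<^sub>1\<close> a conflation with
  \<open>T\<^sub>0, T\<^sub>1 \<in> \<T>\<close>. Replacing \<open>P\<close> by \<open>T\<^sub>0\<close> gives \<open>K \<rightarrow> T\<^sub>0 \<rightarrow> E\<close> with \<open>V \<rightarrow> E \<rightarrow> T\<^sub>1\<close>, and the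
  latter splits. However, \<open>K\<close> need not lie in \<open>\<T>\<^sup>\<bottom>\<close>. Applying the same construction to \<open>K\<close>, with
  \<open>K' \<rightarrow> P' \<rightarrow> K\<close> and \<open>P' \<rightarrow> T\<^sub>0' \<rightarrow> T\<^sub>1'\<close>, gives \<open>K' \<rightarrow> T\<^sub>0' \<rightarrow> L\<close> and \<open>K \<rightarrow> L \<rightarrow> T\<^sub>1'\<close>, where \<open>L \<in> \<T>\<^sup>\<bottom>\<close> as a
  quotient of \<open>T\<^sub>0'\<close>. The pushout \<open>M\<close> of \<open>T\<^sub>0 \<leftarrow> K \<rightarrow> L\<close> is an extension of \<open>T\<^sub>1'\<close> by \<open>T\<^sub>0\<close>, so
  \<open>M \<cong> T\<^sub>0 \<oplus> T\<^sub>1' \<in> \<T>\<close>, and it sits in \<open>L \<rightarrow> M \<rightarrow> E\<close>. The composite \<open>M \<rightarrow> E \<rightarrow> V\<close> is a deflation, and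
  its kernel is an extension of \<open>T\<^sub>1\<close> by \<open>L\<close>, so it lies in \<open>\<T>\<^sup>\<bottom>\<close>.
\<close>

section \<open>Biproducts\<close>

context additive_category
begin

lemma biproduct_commute:
  assumes "biproduct \<C> A B S i\<^sub>A i\<^sub>B p\<^sub>A p\<^sub>B"
  shows "biproduct \<C> B A S i\<^sub>B i\<^sub>A p\<^sub>B p\<^sub>A"
proof -
  have b: "A \<in> Ob \<C>" "B \<in> Ob \<C>" "S \<in> Ob \<C>" "i\<^sub>A \<in> mor \<C> A S" "i\<^sub>B \<in> mor \<C> B S"
    "p\<^sub>A \<in> mor \<C> S A" "p\<^sub>B \<in> mor \<C> S B"
    using assms by (auto simp: biproduct_def)
  interpret SS: abelian_group "Hom \<C> S S" using b Hom_abelian_group by blast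
  have "i\<^sub>A \<cdot> p\<^sub>A \<in> mor \<C> S S" "i\<^sub>B \<cdot> p\<^sub>B \<in> mor \<C> S S"
    using b Comp_closed by blast+
  then show ?thesis using assms SS.a_comm unfolding biproduct_def by auto
qed

lemma biproduct_along_isomorphism:
  assumes "biproduct \<C> A B S i\<^sub>A i\<^sub>B p\<^sub>A p\<^sub>B" and S': "S' \<in> Ob \<C>"
    and f: "f \<in> mor \<C> S S'" and g: "g \<in> mor \<C> S' S"
    and gf: "g \<cdot> f = Id \<C> S" and fg: "f \<cdot> g = Id \<C> S'"
  shows "biproduct \<C> A B S' (f \<cdot> i\<^sub>A) (f \<cdot> i\<^sub>B) (p\<^sub>A \<cdot> g) (p\<^sub>B \<cdot> g)"
proof -
  have b: "A \<in> Ob \<C>" "B \<in> Ob \<C>" "S \<in> Ob \<C>" "i\<^sub>A \<in> mor \<C> A S" "i\<^sub>B \<in> mor \<C> B S"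
    "p\<^sub>A \<in> mor \<C> S A" "p\<^sub>B \<in> mor \<C> S B"
    "p\<^sub>A \<cdot> i\<^sub>A = Id \<C> A" "p\<^sub>B \<cdot> i\<^sub>B = Id \<C> B"
    "p\<^sub>B \<cdot> i\<^sub>A = \<zero>\<^bsub>Hom \<C> A B\<^esub>" "p\<^sub>A \<cdot> i\<^sub>B = \<zero>\<^bsub>Hom \<C> B A\<^esub>"
    "(i\<^sub>A \<cdot> p\<^sub>A) \<oplus>\<^bsub>Hom \<C> S S\<^esub> (i\<^sub>B \<cdot> p\<^sub>B) = Id \<C> S"
    using assms by (auto simp: biproduct_def)
  have cancel: "(p \<cdot> g) \<cdot> (f \<cdot> i) = p \<cdot> i"
    if "X \<in> Ob \<C>" "Y \<in> Ob \<C>" "i \<in> mor \<C> X S" "p \<in> mor \<C> S Y" for X Y i p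
  proof -
    have fi: "f \<cdot> i \<in> mor \<C> X S'" using Comp_closed that b f S' by blast
    have "(p \<cdot> g) \<cdot> (f \<cdot> i) = p \<cdot> (g \<cdot> (f \<cdot> i))"
      using Comp_assoc[OF that(1) S' b(3) that(2) fi g that(4)] .
    also have "g \<cdot> (f \<cdot> i) = i"
      using Comp_assoc[OF that(1) b(3) S' b(3) that(3) f g] Comp_Id_left that b gf by simp
    finally show ?thesis .
  qed
  have conj: "(f \<cdot> i) \<cdot> (p \<cdot> g) = (f \<cdot> (i \<cdot> p)) \<cdot> g"
    if "X \<in> Ob \<C>" "i \<in> mor \<C> X S" "p \<in> mor \<C> S X" for X i p
  proof -
    have fi: "f \<cdot> i \<in> mor \<C> X S'" using Comp_closed that b f S' by blast
    have "(f \<cdot> i) \<cdot> (p \<cdot> g) = ((f \<cdot> i) \<cdot> p) \<cdot> g"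
      using Comp_assoc[OF S' b(3) that(1) S' g that(3) fi] by simp
    also have "(f \<cdot> i) \<cdot> p = f \<cdot> (i \<cdot> p)"
      using Comp_assoc[OF b(3) that(1) b(3) S' that(3) that(2) f] .
    finally show ?thesis .
  qed
  have e: "i\<^sub>A \<cdot> p\<^sub>A \<in> mor \<C> S S" "i\<^sub>B \<cdot> p\<^sub>B \<in> mor \<C> S S"
    using b Comp_closed by blast+
  then have fe: "f \<cdot> (i\<^sub>A \<cdot> p\<^sub>A) \<in> mor \<C> S S'" "f \<cdot> (i\<^sub>B \<cdot> p\<^sub>B) \<in> mor \<C> S S'"
    using b f S' Comp_closed by blast+
  have "((f \<cdot> (i\<^sub>A \<cdot> p\<^sub>A)) \<cdot> g) \<oplus>\<^bsub>Hom \<C> S' S'\<^esub> ((f \<cdot> (i\<^sub>B \<cdot> p\<^sub>B)) \<cdot> g)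
      = ((f \<cdot> (i\<^sub>A \<cdot> p\<^sub>A)) \<oplus>\<^bsub>Hom \<C> S S'\<^esub> (f \<cdot> (i\<^sub>B \<cdot> p\<^sub>B))) \<cdot> g"
    using Comp_add_left[OF S' b(3) S' g fe] by simp
  also have "\<dots> = (f \<cdot> Id \<C> S) \<cdot> g"
    using Comp_add_right[OF b(3) b(3) S' e f] b by simp
  also have "\<dots> = Id \<C> S'" using Comp_Id_right b S' f fg by simp
  finally have sum: "((f \<cdot> i\<^sub>A) \<cdot> (p\<^sub>A \<cdot> g)) \<oplus>\<^bsub>Hom \<C> S' S'\<^esub> ((f \<cdot> i\<^sub>B) \<cdot> (p\<^sub>B \<cdot> g)) = Id \<C> S'"
    using conj b by simp
  have "f \<cdot> i\<^sub>A \<in> mor \<C> A S'" "f \<cdot> i\<^sub>B \<in> mor \<C> B S'" "p\<^sub>A \<cdot> g \<in> mor \<C> S' A" "p\<^sub>B \<cdot> g \<in> mor \<C> S' B"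
    using b f g S' Comp_closed by blast+
  then show ?thesis
    unfolding biproduct_def using b S' cancel sum by simp
qed

lemma biproduct_direct_sum:
  assumes "biproduct \<C> A B S i\<^sub>A i\<^sub>B p\<^sub>A p\<^sub>B"
  shows "direct_sum \<C> 2 (\<lambda>k. if k = 0 then A else B) S
    (\<lambda>k. if k = 0 then i\<^sub>A else i\<^sub>B) (\<lambda>k. if k = 0 then p\<^sub>A else p\<^sub>B)"
proof -
  have b: "A \<in> Ob \<C>" "B \<in> Ob \<C>" "S \<in> Ob \<C>" "i\<^sub>A \<in> mor \<C> A S" "i\<^sub>B \<in> mor \<C> B S"
    "p\<^sub>A \<in> mor \<C> S A" "p\<^sub>B \<in> mor \<C> S B"
    "(i\<^sub>A \<cdot> p\<^sub>A) \<oplus>\<^bsub>Hom \<C> S S\<^esub> (i\<^sub>B \<cdot> p\<^sub>B) = Id \<C> S"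
    using assms by (auto simp: biproduct_def)
  interpret SS: abelian_group "Hom \<C> S S" using b Hom_abelian_group by blast
  have e: "i\<^sub>A \<cdot> p\<^sub>A \<in> mor \<C> S S" "i\<^sub>B \<cdot> p\<^sub>B \<in> mor \<C> S S"
    using b Comp_closed by blast+
  let ?t = "\<lambda>k::nat. (if k = 0 then i\<^sub>A else i\<^sub>B) \<cdot> (if k = 0 then p\<^sub>A else p\<^sub>B)"
  have two: "{..<2::nat} = insert 0 {1}" by auto
  have "finsum (Hom \<C> S S) ?t {..<2} = ?t 0 \<oplus>\<^bsub>Hom \<C> S S\<^esub> finsum (Hom \<C> S S) ?t {1}"
    unfolding two by (rule SS.finsum_insert) (use e in auto)
  also have "finsum (Hom \<C> S S) ?t {1} = ?t 1"
    using SS.finsum_insert[of "{}" 1 ?t] e by simp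
  finally have "finsum (Hom \<C> S S) ?t {..<2} = Id \<C> S" using b by simp
  then show ?thesis
    using assms unfolding direct_sum_def biproduct_def
    by (auto simp: less_2_cases_iff)
qed

end

section \<open>Functoriality of extensions\<close>

context ET1
begin

lemma zero_ext: "\<lbrakk>C \<in> Ob \<C>; A \<in> Ob \<C>\<rbrakk> \<Longrightarrow> \<zero>\<^bsub>Ext \<C> C A\<^esub> \<in> ext \<C> C A"
  by (meson Ext_abelian_group abelian_group_def abelian_monoid.zero_closed)

lemma ExtM_closed:
  "\<lbrakk>C \<in> Ob \<C>; C' \<in> Ob \<C>; A \<in> Ob \<C>; A' \<in> Ob \<C>; c \<in> mor \<C> C' C; a \<in> mor \<C> A A'; \<delta> \<in> ext \<C> C A\<rbrakk>
   \<Longrightarrow> ExtM \<C> c a \<delta> \<in> ext \<C> C' A'"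
  using ExtM_hom[of C C' A A' c a] by (auto simp: hom_def)

lemma ExtM_add:
  assumes "C \<in> Ob \<C>" "C' \<in> Ob \<C>" "A \<in> Ob \<C>" "A' \<in> Ob \<C>" "c \<in> mor \<C> C' C" "a \<in> mor \<C> A A'"
    and "\<delta> \<in> ext \<C> C A" "\<epsilon> \<in> ext \<C> C A"
  shows "ExtM \<C> c a (\<delta> \<oplus>\<^bsub>Ext \<C> C A\<^esub> \<epsilon>) = ExtM \<C> c a \<delta> \<oplus>\<^bsub>Ext \<C> C' A'\<^esub> ExtM \<C> c a \<epsilon>"
  using ExtM_hom[OF assms(1-6)] assms(7,8) by (auto simp: hom_def)

lemma ExtM_zero:
  assumes "C \<in> Ob \<C>" "C' \<in> Ob \<C>" "A \<in> Ob \<C>" "A' \<in> Ob \<C>" "c \<in> mor \<C> C' C" "a \<in> mor \<C> A A'"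
  shows "ExtM \<C> c a \<zero>\<^bsub>Ext \<C> C A\<^esub> = \<zero>\<^bsub>Ext \<C> C' A'\<^esub>"
proof -
  interpret E: abelian_group "Ext \<C> C A" using assms Ext_abelian_group by blast
  interpret E': abelian_group "Ext \<C> C' A'" using assms Ext_abelian_group by blast
  have "ExtM \<C> c a \<zero>\<^bsub>Ext \<C> C A\<^esub> \<oplus>\<^bsub>Ext \<C> C' A'\<^esub> ExtM \<C> c a \<zero>\<^bsub>Ext \<C> C A\<^esub> = ExtM \<C> c a \<zero>\<^bsub>Ext \<C> C A\<^esub>"
    using ExtM_add[OF assms, of "\<zero>\<^bsub>Ext \<C> C A\<^esub>" "\<zero>\<^bsub>Ext \<C> C A\<^esub>"] by simp
  moreover have "ExtM \<C> c a \<zero>\<^bsub>Ext \<C> C A\<^esub> \<in> ext \<C> C' A'" using ExtM_closed[OF assms] by simp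
  ultimately show ?thesis using E'.add.l_cancel_one by metis
qed

lemma push_closed:
  "\<lbrakk>C \<in> Ob \<C>; A \<in> Ob \<C>; A' \<in> Ob \<C>; a \<in> mor \<C> A A'; \<delta> \<in> ext \<C> C A\<rbrakk> \<Longrightarrow> push \<C> C a \<delta> \<in> ext \<C> C A'"
  unfolding push_def using ExtM_closed Id_closed by blast

lemma pull_closed:
  "\<lbrakk>C \<in> Ob \<C>; C' \<in> Ob \<C>; A \<in> Ob \<C>; c \<in> mor \<C> C' C; \<delta> \<in> ext \<C> C A\<rbrakk> \<Longrightarrow> pull \<C> A c \<delta> \<in> ext \<C> C' A"
  unfolding pull_def using ExtM_closed Id_closed by blast

lemma push_zero:
  "\<lbrakk>C \<in> Ob \<C>; A \<in> Ob \<C>; A' \<in> Ob \<C>; a \<in> mor \<C> A A'\<rbrakk>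
   \<Longrightarrow> push \<C> C a \<zero>\<^bsub>Ext \<C> C A\<^esub> = \<zero>\<^bsub>Ext \<C> C A'\<^esub>"
  unfolding push_def using ExtM_zero Id_closed by blast

lemma pull_zero:
  "\<lbrakk>C \<in> Ob \<C>; C' \<in> Ob \<C>; A \<in> Ob \<C>; c \<in> mor \<C> C' C\<rbrakk>
   \<Longrightarrow> pull \<C> A c \<zero>\<^bsub>Ext \<C> C A\<^esub> = \<zero>\<^bsub>Ext \<C> C' A\<^esub>"
  unfolding pull_def using ExtM_zero Id_closed by blast

lemma push_Id: "\<lbrakk>C \<in> Ob \<C>; A \<in> Ob \<C>; \<delta> \<in> ext \<C> C A\<rbrakk> \<Longrightarrow> push \<C> C (Id \<C> A) \<delta> = \<delta>"
  unfolding push_def by (rule ExtM_Id)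

lemma pull_Id: "\<lbrakk>C \<in> Ob \<C>; A \<in> Ob \<C>; \<delta> \<in> ext \<C> C A\<rbrakk> \<Longrightarrow> pull \<C> A (Id \<C> C) \<delta> = \<delta>"
  unfolding pull_def by (rule ExtM_Id)

lemma push_Comp:
  "\<lbrakk>C \<in> Ob \<C>; A \<in> Ob \<C>; A' \<in> Ob \<C>; A'' \<in> Ob \<C>; a \<in> mor \<C> A A'; a' \<in> mor \<C> A' A''; \<delta> \<in> ext \<C> C A\<rbrakk>
   \<Longrightarrow> push \<C> C (a' \<cdot> a) \<delta> = push \<C> C a' (push \<C> C a \<delta>)"
  unfolding push_def
  using ExtM_Comp[of C C C A A' A'' "Id \<C> C" "Id \<C> C" a a' \<delta>] Id_closed Comp_Id_left by metis

lemma pull_Comp: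
  "\<lbrakk>C \<in> Ob \<C>; C' \<in> Ob \<C>; C'' \<in> Ob \<C>; A \<in> Ob \<C>; c \<in> mor \<C> C' C; c' \<in> mor \<C> C'' C'; \<delta> \<in> ext \<C> C A\<rbrakk>
   \<Longrightarrow> pull \<C> A (c \<cdot> c') \<delta> = pull \<C> A c' (pull \<C> A c \<delta>)"
  unfolding pull_def
  using ExtM_Comp[of C C' C'' A A A c c' "Id \<C> A" "Id \<C> A" \<delta>] Id_closed Comp_Id_left by metis

lemma push_pull:
  assumes "C \<in> Ob \<C>" "C' \<in> Ob \<C>" "A \<in> Ob \<C>" "A' \<in> Ob \<C>" "c \<in> mor \<C> C' C" "a \<in> mor \<C> A A'"
    and "\<delta> \<in> ext \<C> C A"
  shows "push \<C> C' a (pull \<C> A c \<delta>) = pull \<C> A' c (push \<C> C a \<delta>)"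
proof -
  have "push \<C> C' a (pull \<C> A c \<delta>) = ExtM \<C> c a \<delta>"
    unfolding push_def pull_def
    using ExtM_Comp[of C C' C' A A A' c "Id \<C> C'" "Id \<C> A" a \<delta>] assms Id_closed
      Comp_Id_right by metis
  also have "\<dots> = pull \<C> A' c (push \<C> C a \<delta>)"
    unfolding push_def pull_def
    using ExtM_Comp[of C C C' A A' A' "Id \<C> C" c a "Id \<C> A'" \<delta>] assms Id_closed
      Comp_Id_left by metis
  finally show ?thesis .
qed

lemma push_zero_mor:
  assumes "C \<in> Ob \<C>" "A \<in> Ob \<C>" "A' \<in> Ob \<C>" "\<delta> \<in> ext \<C> C A"
  shows "push \<C> C \<zero>\<^bsub>Hom \<C> A A'\<^esub> \<delta> = \<zero>\<^bsub>Ext \<C> C A'\<^esub>"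
proof -
  interpret H: abelian_group "Hom \<C> A A'" using assms Hom_abelian_group by blast
  interpret E: abelian_group "Ext \<C> C A'" using assms Ext_abelian_group by blast
  let ?x = "push \<C> C \<zero>\<^bsub>Hom \<C> A A'\<^esub> \<delta>"
  have "?x \<oplus>\<^bsub>Ext \<C> C A'\<^esub> ?x = ?x"
    using ExtM_add_right[of C C A A' "Id \<C> C" "\<zero>\<^bsub>Hom \<C> A A'\<^esub>" "\<zero>\<^bsub>Hom \<C> A A'\<^esub>" \<delta>] assms Id_closed
    unfolding push_def by simp
  moreover have "?x \<in> ext \<C> C A'" using push_closed assms by simp
  ultimately show ?thesis using E.add.l_cancel_one by metis
qed

lemma pull_zero_mor:
  assumes "C \<in> Ob \<C>" "C' \<in> Ob \<C>" "A \<in> Ob \<C>" "\<delta> \<in> ext \<C> C A"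
  shows "pull \<C> A \<zero>\<^bsub>Hom \<C> C' C\<^esub> \<delta> = \<zero>\<^bsub>Ext \<C> C' A\<^esub>"
proof -
  interpret H: abelian_group "Hom \<C> C' C" using assms Hom_abelian_group by blast
  interpret E: abelian_group "Ext \<C> C' A" using assms Ext_abelian_group by blast
  let ?x = "pull \<C> A \<zero>\<^bsub>Hom \<C> C' C\<^esub> \<delta>"
  have "?x \<oplus>\<^bsub>Ext \<C> C' A\<^esub> ?x = ?x"
    using ExtM_add_left[of C C' A A "\<zero>\<^bsub>Hom \<C> C' C\<^esub>" "\<zero>\<^bsub>Hom \<C> C' C\<^esub>" "Id \<C> A" \<delta>] assms Id_closed
    unfolding pull_def by simp
  moreover have "?x \<in> ext \<C> C' A" using pull_closed assms by simp
  ultimately show ?thesis using E.add.l_cancel_one by metis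
qed

text \<open>
  These elements are the components of the isomorphism \<open>\<E>(C, A \<oplus> A') \<cong> \<E>(C, A) \<times> \<E>(C, A')\<close>; what is
  used below is that two extensions of \<open>C\<close> can be prescribed at once.
\<close>

lemma push_biproduct:
  assumes bp: "biproduct \<C> A A' S i i' p p'" and C: "C \<in> Ob \<C>"
    and d: "\<delta> \<in> ext \<C> C A" and d': "\<delta>' \<in> ext \<C> C A'"
  defines "\<eta> \<equiv> push \<C> C i \<delta> \<oplus>\<^bsub>Ext \<C> C S\<^esub> push \<C> C i' \<delta>'"
  shows "\<eta> \<in> ext \<C> C S" and "push \<C> C p \<eta> = \<delta>" and "push \<C> C p' \<eta> = \<delta>'"
proof -
  have b: "A \<in> Ob \<C>" "A' \<in> Ob \<C>" "S \<in> Ob \<C>" "i \<in> mor \<C> A S" "i' \<in> mor \<C> A' S"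
    "p \<in> mor \<C> S A" "p' \<in> mor \<C> S A'" "p \<cdot> i = Id \<C> A" "p' \<cdot> i' = Id \<C> A'"
    "p' \<cdot> i = \<zero>\<^bsub>Hom \<C> A A'\<^esub>" "p \<cdot> i' = \<zero>\<^bsub>Hom \<C> A' A\<^esub>"
    using bp by (auto simp: biproduct_def)
  interpret S: abelian_group "Ext \<C> C S" using b C Ext_abelian_group by blast
  interpret A: abelian_group "Ext \<C> C A" using b C Ext_abelian_group by blast
  interpret A': abelian_group "Ext \<C> C A'" using b C Ext_abelian_group by blast
  have cl: "push \<C> C i \<delta> \<in> ext \<C> C S" "push \<C> C i' \<delta>' \<in> ext \<C> C S"
    using push_closed b C d d' by blast+
  show "\<eta> \<in> ext \<C> C S" unfolding \<eta>_def using cl by simp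
  have "push \<C> C p \<eta> = push \<C> C p (push \<C> C i \<delta>) \<oplus>\<^bsub>Ext \<C> C A\<^esub> push \<C> C p (push \<C> C i' \<delta>')"
    unfolding \<eta>_def push_def[of _ _ p] using ExtM_add Id_closed C b cl by blast
  also have "\<dots> = \<delta>"
    unfolding push_Comp[OF C b(1,3,1,4,6) d, symmetric] push_Comp[OF C b(2,3,1,5,6) d', symmetric]
    using b C d d' push_Id push_zero_mor by simp
  finally show "push \<C> C p \<eta> = \<delta>" .
  have "push \<C> C p' \<eta> = push \<C> C p' (push \<C> C i \<delta>) \<oplus>\<^bsub>Ext \<C> C A'\<^esub> push \<C> C p' (push \<C> C i' \<delta>')"
    unfolding \<eta>_def push_def[of _ _ p'] using ExtM_add Id_closed C b cl by blast
  also have "\<dots> = \<delta>'"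
    unfolding push_Comp[OF C b(1,3,2,4,7) d, symmetric] push_Comp[OF C b(2,3,2,5,7) d', symmetric]
    using b C d d' push_Id push_zero_mor by simp
  finally show "push \<C> C p' \<eta> = \<delta>'" .
qed

lemma pull_biproduct:
  assumes bp: "biproduct \<C> C C' S i i' p p'" and A: "A \<in> Ob \<C>"
    and d: "\<delta> \<in> ext \<C> C A" and d': "\<delta>' \<in> ext \<C> C' A"
  defines "\<eta> \<equiv> pull \<C> A p \<delta> \<oplus>\<^bsub>Ext \<C> S A\<^esub> pull \<C> A p' \<delta>'"
  shows "\<eta> \<in> ext \<C> S A" and "pull \<C> A i \<eta> = \<delta>" and "pull \<C> A i' \<eta> = \<delta>'"
proof -
  have b: "C \<in> Ob \<C>" "C' \<in> Ob \<C>" "S \<in> Ob \<C>" "i \<in> mor \<C> C S" "i' \<in> mor \<C> C' S"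
    "p \<in> mor \<C> S C" "p' \<in> mor \<C> S C'" "p \<cdot> i = Id \<C> C" "p' \<cdot> i' = Id \<C> C'"
    "p' \<cdot> i = \<zero>\<^bsub>Hom \<C> C C'\<^esub>" "p \<cdot> i' = \<zero>\<^bsub>Hom \<C> C' C\<^esub>"
    using bp by (auto simp: biproduct_def)
  interpret S: abelian_group "Ext \<C> S A" using b A Ext_abelian_group by blast
  interpret C: abelian_group "Ext \<C> C A" using b A Ext_abelian_group by blast
  interpret C': abelian_group "Ext \<C> C' A" using b A Ext_abelian_group by blast
  have cl: "pull \<C> A p \<delta> \<in> ext \<C> S A" "pull \<C> A p' \<delta>' \<in> ext \<C> S A"
    using pull_closed b A d d' by blast+
  show "\<eta> \<in> ext \<C> S A" unfolding \<eta>_def using cl by simp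
  have "pull \<C> A i \<eta> = pull \<C> A i (pull \<C> A p \<delta>) \<oplus>\<^bsub>Ext \<C> C A\<^esub> pull \<C> A i (pull \<C> A p' \<delta>')"
    unfolding \<eta>_def pull_def[of _ _ i] using ExtM_add Id_closed A b cl by blast
  also have "\<dots> = \<delta>"
    unfolding pull_Comp[OF b(1,3,1) A b(6,4) d, symmetric] pull_Comp[OF b(2,3,1) A b(7,4) d', symmetric]
    using b A d d' pull_Id pull_zero_mor by simp
  finally show "pull \<C> A i \<eta> = \<delta>" .
  have "pull \<C> A i' \<eta> = pull \<C> A i' (pull \<C> A p \<delta>) \<oplus>\<^bsub>Ext \<C> C' A\<^esub> pull \<C> A i' (pull \<C> A p' \<delta>')"
    unfolding \<eta>_def pull_def[of _ _ i'] using ExtM_add Id_closed A b cl by blast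
  also have "\<dots> = \<delta>'"
    unfolding pull_Comp[OF b(1,3,2) A b(6,5) d, symmetric] pull_Comp[OF b(2,3,2) A b(7,5) d', symmetric]
    using b A d d' pull_Id pull_zero_mor by simp
  finally show "pull \<C> A i' \<eta> = \<delta>'" .
qed

end

section \<open>Realizations and split conflations\<close>

context ET2
begin

lemma realizable:
  assumes "C \<in> Ob \<C>" "A \<in> Ob \<C>" "\<delta> \<in> ext \<C> C A"
  obtains x B y where "realizes \<C> \<delta> A x B y C"
proof -
  obtain t where t: "t \<in> seqs \<C> A C" "Real \<C> C A \<delta> = seq_equiv \<C> A C `` {t}"
    using Real_class[OF assms] by (auto elim: quotientE)
  obtain x B y where [simp]: "t = (x, B, y)" using prod_cases3 by blast
  have s: "B \<in> Ob \<C>" "x \<in> mor \<C> A B" "y \<in> mor \<C> B C" using t by (auto simp: seqs_def)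
  have "isomorphism \<C> B B (Id \<C> B) \<and> Id \<C> B \<cdot> x = x \<and> y \<cdot> Id \<C> B = y"
    using s assms Id_closed Comp_Id_left Comp_Id_right by (auto simp: isomorphism_def)
  then have "(t, t) \<in> seq_equiv \<C> A C"
    unfolding seq_equiv_def using t(1) by simp blast
  then have "t \<in> Real \<C> C A \<delta>" using t by blast
  then show thesis using that assms unfolding realizes_def by auto
qed

lemma realizesD:
  assumes "realizes \<C> \<delta> A x B y C"
  shows "A \<in> Ob \<C>" "B \<in> Ob \<C>" "C \<in> Ob \<C>" "x \<in> mor \<C> A B" "y \<in> mor \<C> B C" "\<delta> \<in> ext \<C> C A"
proof -
  have r: "A \<in> Ob \<C>" "C \<in> Ob \<C>" "\<delta> \<in> ext \<C> C A" "(x, B, y) \<in> Real \<C> C A \<delta>"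
    using assms by (auto simp: realizes_def)
  obtain t where "Real \<C> C A \<delta> = seq_equiv \<C> A C `` {t}"
    using Real_class[OF r(2,1,3)] by (auto elim: quotientE)
  then have "(t, (x, B, y)) \<in> seq_equiv \<C> A C" using r by blast
  then have "(x, B, y) \<in> seqs \<C> A C" by (auto simp: seq_equiv_def)
  then show "A \<in> Ob \<C>" "B \<in> Ob \<C>" "C \<in> Ob \<C>" "x \<in> mor \<C> A B" "y \<in> mor \<C> B C" "\<delta> \<in> ext \<C> C A"
    using r by (auto simp: seqs_def)
qed

lemma realizations_isomorphic:
  assumes "realizes \<C> \<delta> A x B y C" "realizes \<C> \<delta> A x' B' y' C"
  obtains f g where "f \<in> mor \<C> B B'" "g \<in> mor \<C> B' B" "g \<cdot> f = Id \<C> B" "f \<cdot> g = Id \<C> B'"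
    "f \<cdot> x = x'" "y \<cdot> g = y'"
proof -
  note D = realizesD[OF assms(1)] and D' = realizesD[OF assms(2)]
  obtain t where t: "t \<in> seqs \<C> A C" "Real \<C> C A \<delta> = seq_equiv \<C> A C `` {t}"
    using Real_class[OF D(3,1,6)] by (auto elim: quotientE)
  obtain x0 B0 y0 where t0: "t = (x0, B0, y0)" using prod_cases3 by blast
  have "((x0, B0, y0), (x, B, y)) \<in> seq_equiv \<C> A C" "((x0, B0, y0), (x', B', y')) \<in> seq_equiv \<C> A C"
    using assms t t0 by (auto simp: realizes_def)
  then obtain b b' where b: "isomorphism \<C> B0 B b" "b \<cdot> x0 = x" "y \<cdot> b = y0"
    and b': "isomorphism \<C> B0 B' b'" "b' \<cdot> x0 = x'" "y' \<cdot> b' = y0"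
    and s: "(x0, B0, y0) \<in> seqs \<C> A C"
    by (auto simp: seq_equiv_def)
  have O: "B0 \<in> Ob \<C>" "x0 \<in> mor \<C> A B0" "y0 \<in> mor \<C> B0 C" using s by (auto simp: seqs_def)
  obtain c where c: "b \<in> mor \<C> B0 B" "c \<in> mor \<C> B B0" "c \<cdot> b = Id \<C> B0" "b \<cdot> c = Id \<C> B"
    using b by (auto simp: isomorphism_def)
  obtain c' where c': "b' \<in> mor \<C> B0 B'" "c' \<in> mor \<C> B' B0" "c' \<cdot> b' = Id \<C> B0" "b' \<cdot> c' = Id \<C> B'"
    using b' by (auto simp: isomorphism_def)
  have inv: "(v \<cdot> u') \<cdot> (u \<cdot> v') = Id \<C> Y"
    if "Y \<in> Ob \<C>" "Z \<in> Ob \<C>" "v \<in> mor \<C> B0 Y" "v' \<in> mor \<C> Y B0" "u \<in> mor \<C> B0 Z" "u' \<in> mor \<C> Z B0"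
      "u' \<cdot> u = Id \<C> B0" "v \<cdot> v' = Id \<C> Y" for Y Z u u' v v'
  proof -
    have uv: "u \<cdot> v' \<in> mor \<C> Y Z" using Comp_closed that O by blast
    have "(v \<cdot> u') \<cdot> (u \<cdot> v') = v \<cdot> (u' \<cdot> (u \<cdot> v'))"
      using Comp_assoc[OF that(1,2) O(1) that(1) uv that(6,3)] .
    also have "u' \<cdot> (u \<cdot> v') = v'"
      using Comp_assoc[OF that(1) O(1) that(2) O(1) that(4,5,6)] that O Comp_Id_left by simp
    finally show ?thesis using that by simp
  qed
  have "b' \<cdot> c \<in> mor \<C> B B'" "b \<cdot> c' \<in> mor \<C> B' B" using Comp_closed c c' O D D' by blast+
  moreover have "(b \<cdot> c') \<cdot> (b' \<cdot> c) = Id \<C> B" using inv c c' D D' by blast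
  moreover have "(b' \<cdot> c) \<cdot> (b \<cdot> c') = Id \<C> B'" using inv c c' D D' by blast
  moreover have "(b' \<cdot> c) \<cdot> x = x'"
  proof -
    have "c \<cdot> x = x0" using Comp_assoc[OF D(1) O(1) D(2) O(1) O(2) c(1) c(2)] b c O D Comp_Id_left by simp
    then show ?thesis using Comp_assoc[OF D(1) D(2) O(1) D'(2) D(4) c(2) c'(1)] b' by simp
  qed
  moreover have "y \<cdot> (b \<cdot> c') = y'"
  proof -
    have "y0 \<cdot> c' = y'"
      using Comp_assoc[OF D'(2) O(1) D'(2) D'(3) c'(2) c'(1) D'(5)] b' c' D' Comp_Id_right by simp
    then show ?thesis using Comp_assoc[OF D'(2) O(1) D(2) D(3) c'(2) c(1) D(5)] b by simp
  qed
  ultimately show thesis using that by blast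
qed

text \<open>
  The realization of \<open>0\<close> is prescribed only for one biproduct sequence; since any other realization is
  equivalent to it, the biproduct structure can be moved along the equivalence.
\<close>

lemma zero_extension_biproduct:
  assumes "realizes \<C> \<zero>\<^bsub>Ext \<C> C A\<^esub> A x B y C"
  obtains j p where "biproduct \<C> A C B x j p y"
proof -
  note D = realizesD[OF assms]
  obtain S iA iC pA pC where bp: "biproduct \<C> A C S iA iC pA pC"
    using biproduct_exists D by blast
  obtain f g where fg: "f \<in> mor \<C> S B" "g \<in> mor \<C> B S" "g \<cdot> f = Id \<C> S" "f \<cdot> g = Id \<C> B"
    "f \<cdot> iA = x" "pC \<cdot> g = y"
    using realizations_isomorphic[OF Real_zero[OF bp] assms] .
  show thesis using that biproduct_along_isomorphism[OF bp D(2) fg(1-4)] fg by simp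
qed

end

section \<open>Exactness of the extension functors\<close>

context extriangulated_category
begin

text \<open>
  Exactness of \<open>\<E>(T, A) \<rightarrow> \<E>(T, B) \<rightarrow> \<E>(T, C)\<close> in the middle. Composing \<open>A \<rightarrow> B\<close> with the inflation
  \<open>B \<rightarrow> G\<close> of a realization of \<open>\<beta>\<close> yields, by (ET4), a conflation \<open>A \<rightarrow> G \<rightarrow> E\<close> and a realization
  \<open>C \<rightarrow> E \<rightarrow> T\<close> of \<open>y\<^sub>* \<beta> = 0\<close>. A section \<open>T \<rightarrow> E\<close> of the latter pulls the class of the former back to a
  preimage of \<open>\<beta>\<close>.
\<close>

lemma push_kernel:
  assumes r: "realizes \<C> \<delta> A x B y C" and T: "T \<in> Ob \<C>"
    and b: "\<beta> \<in> ext \<C> T B" and z: "push \<C> T y \<beta> = \<zero>\<^bsub>Ext \<C> T C\<^esub>"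
  obtains \<alpha> where "\<alpha> \<in> ext \<C> T A" "push \<C> T x \<alpha> = \<beta>"
proof -
  note D = realizesD[OF r]
  obtain g G g' where rb: "realizes \<C> \<beta> B g G g' T" using realizable[OF T D(2) b] .
  obtain E h h' d e \<delta>'' where E: "realizes \<C> \<delta>'' A h G h' E"
    "realizes \<C> (push \<C> T y \<beta>) C d E e T" "push \<C> E x \<delta>'' = pull \<C> B e \<beta>"
    using ET4[OF r rb] by blast
  note D' = realizesD[OF E(1)] realizesD[OF E(2)]
  obtain j p where "biproduct \<C> C T E d j p e"
    using zero_extension_biproduct[OF E(2)[unfolded z]] .
  then have j: "j \<in> mor \<C> T E" "e \<cdot> j = Id \<C> T" by (auto simp: biproduct_def)
  have "push \<C> T x (pull \<C> A j \<delta>'') = pull \<C> B j (push \<C> E x \<delta>'')"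
    using push_pull D D' T j by blast
  also have "\<dots> = pull \<C> B (e \<cdot> j) \<beta>"
    using pull_Comp[of T E T B e j \<beta>] E D D' T j b by simp
  also have "\<dots> = \<beta>" using j pull_Id T D b by simp
  finally show thesis using that pull_closed D D' T j by blast
qed

text \<open>
  The dual argument: exactness of \<open>\<E>(C, X) \<rightarrow> \<E>(B, X) \<rightarrow> \<E>(A, X)\<close> in the middle.
\<close>

lemma pull_kernel:
  assumes r: "realizes \<C> \<delta> A x B y C" and X: "X \<in> Ob \<C>"
    and b: "\<beta> \<in> ext \<C> B X" and z: "pull \<C> X x \<beta> = \<zero>\<^bsub>Ext \<C> A X\<^esub>"
  obtains \<gamma> where "\<gamma> \<in> ext \<C> C X" "pull \<C> X y \<gamma> = \<beta>"
proof -
  note D = realizesD[OF r]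
  obtain g' G g where rb: "realizes \<C> \<beta> X g' G g B" using realizable[OF D(2) X b] .
  obtain E h h' d e \<delta>'' where E: "realizes \<C> \<delta>'' E h' G h C"
    "realizes \<C> (pull \<C> X x \<beta>) X e E d A" "pull \<C> E y \<delta>'' = push \<C> B e \<beta>"
    using ET4_op[OF r rb] by blast
  note D' = realizesD[OF E(1)] realizesD[OF E(2)]
  obtain j p where "biproduct \<C> X A E e j p d"
    using zero_extension_biproduct[OF E(2)[unfolded z]] .
  then have p: "p \<in> mor \<C> E X" "p \<cdot> e = Id \<C> X" by (auto simp: biproduct_def)
  have "pull \<C> X y (push \<C> C p \<delta>'') = push \<C> B p (pull \<C> E y \<delta>'')"
    using push_pull[of C B E X y p \<delta>''] D D' X p by simp
  also have "\<dots> = push \<C> B (p \<cdot> e) \<beta>"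
    using push_Comp[of B X E X e p \<beta>] E D D' X p b by simp
  also have "\<dots> = \<beta>" using p push_Id X D b by simp
  finally show thesis using that push_closed D D' X p by blast
qed

text \<open>
  A section of the deflation extends to a map from the split sequence to the realization of \<open>\<delta>\<close> that
  is the identity on \<open>P\<close>, so \<open>\<delta>\<close> is a pushforward of \<open>0\<close>.
\<close>

lemma ext_projective_zero:
  assumes P: "projective \<C> P" and X: "X \<in> Ob \<C>" and d: "\<delta> \<in> ext \<C> P X"
  shows "\<delta> = \<zero>\<^bsub>Ext \<C> P X\<^esub>"
proof -
  have PO: "P \<in> Ob \<C>" using P by (simp add: projective_def)
  obtain x B y where r: "realizes \<C> \<delta> X x B y P" using realizable[OF PO X d] .
  note D = realizesD[OF r]
  have "deflation \<C> B P y" using r unfolding deflation_def conflation_def by blast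
  then obtain s where s: "s \<in> mor \<C> P B" "y \<cdot> s = Id \<C> P"
    using P Id_closed[OF PO] unfolding projective_def by blast
  obtain S i j p q where bp: "biproduct \<C> X P S i j p q" using biproduct_exists X PO by blast
  have S: "S \<in> Ob \<C>" "q \<in> mor \<C> S P" using bp by (auto simp: biproduct_def)
  have sq: "s \<cdot> q \<in> mor \<C> S B" using Comp_closed S s D by blast
  have "Id \<C> P \<cdot> q = y \<cdot> (s \<cdot> q)"
    using Comp_assoc[OF S(1) PO D(2) PO S(2) s(1) D(5)] s by simp
  then obtain a where "ext_morphism \<C> P X \<zero>\<^bsub>Ext \<C> P X\<^esub> P X \<delta> a (Id \<C> P)"
    using ET3_op[OF Real_zero[OF bp] r sq Id_closed[OF PO]] by blast
  then show ?thesis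
    using push_zero pull_Id PO X d unfolding ext_morphism_def by auto
qed

lemma ext_injective_zero:
  assumes I: "injective \<C> I" and X: "X \<in> Ob \<C>" and d: "\<delta> \<in> ext \<C> X I"
  shows "\<delta> = \<zero>\<^bsub>Ext \<C> X I\<^esub>"
proof -
  have IO: "I \<in> Ob \<C>" using I by (simp add: injective_def)
  obtain x B y where r: "realizes \<C> \<delta> I x B y X" using realizable[OF X IO d] .
  note D = realizesD[OF r]
  have "inflation \<C> I B x" using r unfolding inflation_def conflation_def by blast
  then obtain s where s: "s \<in> mor \<C> B I" "s \<cdot> x = Id \<C> I"
    using I Id_closed[OF IO] unfolding injective_def by blast
  obtain S i j p q where bp: "biproduct \<C> I X S i j p q" using biproduct_exists X IO by blast
  have S: "S \<in> Ob \<C>" "i \<in> mor \<C> I S" using bp by (auto simp: biproduct_def)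
  have si: "i \<cdot> s \<in> mor \<C> B S" using Comp_closed S s D by blast
  have "(i \<cdot> s) \<cdot> x = i \<cdot> Id \<C> I"
    using Comp_assoc[OF IO D(2) IO S(1) D(4) s(1) S(2)] s by simp
  then obtain c where "ext_morphism \<C> X I \<delta> X I \<zero>\<^bsub>Ext \<C> X I\<^esub> (Id \<C> I) c"
    using ET3[OF r Real_zero[OF bp] Id_closed[OF IO] si] by blast
  then show ?thesis
    using pull_zero push_Id IO X d unfolding ext_morphism_def by auto
qed

section \<open>Pushouts of inflations and pullbacks of deflations\<close>

text \<open>
  Realize the extension of \<open>C\<^sub>1 \<oplus> C\<^sub>2\<close> by \<open>K\<close> with components \<open>\<delta>\<^sub>1\<close> and \<open>\<delta>\<^sub>2\<close> by \<open>K \<rightarrow> M \<rightarrow> C\<^sub>1 \<oplus> C\<^sub>2\<close>, and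
  apply (ET4)\<open>\<^sup>o\<^sup>p\<close> to this and each of the two split deflations from \<open>C\<^sub>1 \<oplus> C\<^sub>2\<close>. The middle terms that
  arise realize the same extensions as \<open>B\<^sub>1\<close> and \<open>B\<^sub>2\<close>, so they agree with these up to isomorphism.
\<close>

lemma pushout_of_inflations:
  assumes r\<^sub>1: "realizes \<C> \<delta>\<^sub>1 K x\<^sub>1 B\<^sub>1 y\<^sub>1 C\<^sub>1" and r\<^sub>2: "realizes \<C> \<delta>\<^sub>2 K x\<^sub>2 B\<^sub>2 y\<^sub>2 C\<^sub>2"
  obtains M B\<^sub>1' B\<^sub>2' u\<^sub>1 v\<^sub>1 u\<^sub>2 v\<^sub>2 s\<^sub>1 t\<^sub>1 s\<^sub>2 t\<^sub>2 where
    "conflation \<C> B\<^sub>2' u\<^sub>2 M v\<^sub>2 C\<^sub>1" "conflation \<C> B\<^sub>1' u\<^sub>1 M v\<^sub>1 C\<^sub>2"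
    "realizes \<C> \<delta>\<^sub>1 K s\<^sub>1 B\<^sub>1' t\<^sub>1 C\<^sub>1" "realizes \<C> \<delta>\<^sub>2 K s\<^sub>2 B\<^sub>2' t\<^sub>2 C\<^sub>2"
proof -
  note D\<^sub>1 = realizesD[OF r\<^sub>1] and D\<^sub>2 = realizesD[OF r\<^sub>2]
  obtain S i\<^sub>1 i\<^sub>2 p\<^sub>1 p\<^sub>2 where bp: "biproduct \<C> C\<^sub>1 C\<^sub>2 S i\<^sub>1 i\<^sub>2 p\<^sub>1 p\<^sub>2"
    using biproduct_exists D\<^sub>1 D\<^sub>2 by blast
  have S: "S \<in> Ob \<C>" using bp by (simp add: biproduct_def)
  obtain \<eta> where \<eta>: "\<eta> \<in> ext \<C> S K" "pull \<C> K i\<^sub>1 \<eta> = \<delta>\<^sub>1" "pull \<C> K i\<^sub>2 \<eta> = \<delta>\<^sub>2"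
    using pull_biproduct[OF bp D\<^sub>1(1) D\<^sub>1(6) D\<^sub>2(6)] by blast
  obtain m M n where r: "realizes \<C> \<eta> K m M n S" using realizable[OF S D\<^sub>1(1) \<eta>(1)] .
  obtain B\<^sub>1' h\<^sub>1 h\<^sub>1' d\<^sub>1 e\<^sub>1 \<epsilon>\<^sub>1 where
    1: "realizes \<C> \<epsilon>\<^sub>1 B\<^sub>1' h\<^sub>1' M h\<^sub>1 C\<^sub>2" "realizes \<C> \<delta>\<^sub>1 K e\<^sub>1 B\<^sub>1' d\<^sub>1 C\<^sub>1"
    using ET4_op[OF Real_zero[OF bp] r] unfolding \<eta> by blast
  obtain B\<^sub>2' h\<^sub>2 h\<^sub>2' d\<^sub>2 e\<^sub>2 \<epsilon>\<^sub>2 where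
    2: "realizes \<C> \<epsilon>\<^sub>2 B\<^sub>2' h\<^sub>2' M h\<^sub>2 C\<^sub>1" "realizes \<C> \<delta>\<^sub>2 K e\<^sub>2 B\<^sub>2' d\<^sub>2 C\<^sub>2"
    using ET4_op[OF Real_zero[OF biproduct_commute[OF bp]] r] unfolding \<eta> by blast
  show thesis using that[OF _ _ 1(2) 2(2)] 1(1) 2(1) unfolding conflation_def by blast
qed

lemma pullback_of_deflations:
  assumes r\<^sub>1: "realizes \<C> \<delta>\<^sub>1 A\<^sub>1 x\<^sub>1 B\<^sub>1 y\<^sub>1 C" and r\<^sub>2: "realizes \<C> \<delta>\<^sub>2 A\<^sub>2 x\<^sub>2 B\<^sub>2 y\<^sub>2 C"
  obtains M B\<^sub>1' B\<^sub>2' u\<^sub>1 v\<^sub>1 u\<^sub>2 v\<^sub>2 s\<^sub>1 t\<^sub>1 s\<^sub>2 t\<^sub>2 where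
    "conflation \<C> A\<^sub>2 u\<^sub>2 M v\<^sub>2 B\<^sub>1'" "conflation \<C> A\<^sub>1 u\<^sub>1 M v\<^sub>1 B\<^sub>2'"
    "realizes \<C> \<delta>\<^sub>1 A\<^sub>1 s\<^sub>1 B\<^sub>1' t\<^sub>1 C" "realizes \<C> \<delta>\<^sub>2 A\<^sub>2 s\<^sub>2 B\<^sub>2' t\<^sub>2 C"
proof -
  note D\<^sub>1 = realizesD[OF r\<^sub>1] and D\<^sub>2 = realizesD[OF r\<^sub>2]
  obtain S i\<^sub>1 i\<^sub>2 p\<^sub>1 p\<^sub>2 where bp: "biproduct \<C> A\<^sub>1 A\<^sub>2 S i\<^sub>1 i\<^sub>2 p\<^sub>1 p\<^sub>2"
    using biproduct_exists D\<^sub>1 D\<^sub>2 by blast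
  have S: "S \<in> Ob \<C>" using bp by (simp add: biproduct_def)
  obtain \<eta> where \<eta>: "\<eta> \<in> ext \<C> C S" "push \<C> C p\<^sub>1 \<eta> = \<delta>\<^sub>1" "push \<C> C p\<^sub>2 \<eta> = \<delta>\<^sub>2"
    using push_biproduct[OF bp D\<^sub>1(3) D\<^sub>1(6) D\<^sub>2(6)] by blast
  obtain m M n where r: "realizes \<C> \<eta> S m M n C" using realizable[OF D\<^sub>1(3) S \<eta>(1)] .
  obtain B\<^sub>2' h\<^sub>2 h\<^sub>2' d\<^sub>2 e\<^sub>2 \<epsilon>\<^sub>2 where
    2: "realizes \<C> \<epsilon>\<^sub>2 A\<^sub>1 h\<^sub>2 M h\<^sub>2' B\<^sub>2'" "realizes \<C> \<delta>\<^sub>2 A\<^sub>2 d\<^sub>2 B\<^sub>2' e\<^sub>2 C"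
    using ET4[OF Real_zero[OF bp] r] unfolding \<eta> by blast
  obtain B\<^sub>1' h\<^sub>1 h\<^sub>1' d\<^sub>1 e\<^sub>1 \<epsilon>\<^sub>1 where
    1: "realizes \<C> \<epsilon>\<^sub>1 A\<^sub>2 h\<^sub>1 M h\<^sub>1' B\<^sub>1'" "realizes \<C> \<delta>\<^sub>1 A\<^sub>1 d\<^sub>1 B\<^sub>1' e\<^sub>1 C"
    using ET4[OF Real_zero[OF biproduct_commute[OF bp]] r] unfolding \<eta> by blast
  show thesis using that[OF _ _ 1(2) 2(2)] 1(1) 2(1) unfolding conflation_def by blast
qed

section \<open>Projective presentations\<close>

lemma projective_summand:
  assumes bp: "biproduct \<C> A B P i\<^sub>A i\<^sub>B p\<^sub>A p\<^sub>B" and P: "projective \<C> P"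
  shows "projective \<C> B"
proof -
  have b: "B \<in> Ob \<C>" "P \<in> Ob \<C>" "i\<^sub>B \<in> mor \<C> B P" "p\<^sub>B \<in> mor \<C> P B" "p\<^sub>B \<cdot> i\<^sub>B = Id \<C> B"
    using bp by (auto simp: biproduct_def)
  have "\<exists>g \<in> mor \<C> B Y. y \<cdot> g = f" if y: "deflation \<C> Y C y" and f: "f \<in> mor \<C> B C" for Y C y f
  proof -
    have O: "Y \<in> Ob \<C>" "C \<in> Ob \<C>" "y \<in> mor \<C> Y C"
      using y realizesD(2,3,5) unfolding deflation_def conflation_def by metis+
    have "f \<cdot> p\<^sub>B \<in> mor \<C> P C" using Comp_closed b O f by blast
    then obtain g where g: "g \<in> mor \<C> P Y" "y \<cdot> g = f \<cdot> p\<^sub>B"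
      using P y unfolding projective_def by blast
    have "y \<cdot> (g \<cdot> i\<^sub>B) = (y \<cdot> g) \<cdot> i\<^sub>B"
      using Comp_assoc[OF b(1,2) O(1,2) b(3) g(1) O(3)] by simp
    also have "\<dots> = f \<cdot> (p\<^sub>B \<cdot> i\<^sub>B)"
      using Comp_assoc[OF b(1,2,1) O(2) b(3,4) f] g by simp
    also have "\<dots> = f" using b Comp_Id_right O f by simp
    finally have "y \<cdot> (g \<cdot> i\<^sub>B) = f" .
    moreover have "g \<cdot> i\<^sub>B \<in> mor \<C> B Y" using Comp_closed b O g by blast
    ultimately show ?thesis by blast
  qed
  then show ?thesis using b unfolding projective_def by blast
qed

text \<open>
  Pushing forward along \<open>Id = 0\<close> is both the identity and zero.
\<close>

lemma ext_zero_object: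
  assumes Z: "zero_object \<C> Z" and C: "C \<in> Ob \<C>" and d: "\<delta> \<in> ext \<C> C Z"
  shows "\<delta> = \<zero>\<^bsub>Ext \<C> C Z\<^esub>"
proof -
  have ZO: "Z \<in> Ob \<C>" using Z by (simp add: zero_object_def)
  have "Id \<C> Z = \<zero>\<^bsub>Hom \<C> Z Z\<^esub>" using Z Id_closed[OF ZO] unfolding zero_object_def by blast
  then show ?thesis using push_Id[OF C ZO d] push_zero_mor[OF C ZO ZO d] by simp
qed

text \<open>
  A resolution of length at most \<open>1\<close> contains a conflation \<open>0 \<rightarrow> P\<^sub>1 \<rightarrow> K\<^sub>1\<close>, which splits, so the
  syzygy \<open>K\<^sub>1\<close> is itself projective.
\<close>

lemma projective_presentation:
  assumes "pd \<C> A \<le> 1"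
  obtains P\<^sub>0 P\<^sub>1 x y where "projective \<C> P\<^sub>0" "projective \<C> P\<^sub>1" "conflation \<C> P\<^sub>1 x P\<^sub>0 y A"
proof -
  have Inf_le: "\<exists>a\<in>X. a \<le> 1" if "Inf X \<le> 1" for X :: "enat set"
  proof -
    have "X \<noteq> {}" using that by (auto simp: Inf_enat_def)
    then have "Inf X \<in> X" by (auto simp: Inf_enat_def intro: LeastI)
    then show ?thesis using that by blast
  qed
  obtain P K x y where res: "projective_resolution \<C> A P K x y" "resolution_length \<C> P K \<le> 1"
    using Inf_le[OF assms[unfolded pd_def]] by blast
  obtain n where n: "enat n \<le> 1" "\<forall>i>n. zero_object \<C> (P i) \<and> zero_object \<C> (K i)"
    using Inf_le[OF res(2)[unfolded resolution_length_def]] by blast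
  \<comment> \<open>Length \<open>1\<close> means \<open>P\<^sub>i = K\<^sub>i = 0\<close> for \<open>i \<ge> 2\<close>.\<close>
  have z: "zero_object \<C> (K 2)" using n by (simp add: one_enat_def)
  have proj: "projective \<C> (P i)" and con: "conflation \<C> (K (Suc i)) (x i) (P i) (y i) (K i)"
    and K0: "K 0 = A" for i
    using res(1) by (auto simp: projective_resolution_def)
  obtain \<delta> where r: "realizes \<C> \<delta> (K 2) (x 1) (P 1) (y 1) (K 1)"
    using con[of 1] by (auto simp: conflation_def numeral_2_eq_2)
  have "\<delta> = \<zero>\<^bsub>Ext \<C> (K 1) (K 2)\<^esub>" using ext_zero_object[OF z] realizesD[OF r] by blast
  then obtain j p where "biproduct \<C> (K 2) (K 1) (P 1) (x 1) j p (y 1)"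
    using zero_extension_biproduct r by blast
  then have "projective \<C> (K 1)" using projective_summand proj by blast
  then show thesis using that[OF proj[of 0]] con[of 0] K0 by simp
qed

section \<open>Closure properties of the orthogonal subcategory\<close>

lemma perp1I:
  assumes "\<T> \<subseteq> Ob \<C>" "X \<in> Ob \<C>"
    and "\<And>T \<delta>. \<lbrakk>T \<in> \<T>; T \<in> Ob \<C>; \<delta> \<in> ext \<C> T X\<rbrakk> \<Longrightarrow> \<delta> = \<zero>\<^bsub>Ext \<C> T X\<^esub>"
  shows "X \<in> perp1 \<C> \<T>"
  using assms zero_ext unfolding perp1_def by blast

lemma perp1D:
  assumes "X \<in> perp1 \<C> \<T>"
  shows "X \<in> Ob \<C>" and "\<lbrakk>T \<in> \<T>; \<delta> \<in> ext \<C> T X\<rbrakk> \<Longrightarrow> \<delta> = \<zero>\<^bsub>Ext \<C> T X\<^esub>"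
  using assms by (auto simp: perp1_def)

lemma perp1_retract:
  assumes T: "\<T> \<subseteq> Ob \<C>" and B: "B \<in> perp1 \<C> \<T>" and A: "A \<in> Ob \<C>"
    and s: "s \<in> mor \<C> A B" and r: "r \<in> mor \<C> B A" and rs: "r \<cdot> s = Id \<C> A"
  shows "A \<in> perp1 \<C> \<T>"
proof (rule perp1I[OF T A])
  fix T \<delta> assume t: "T \<in> \<T>" "T \<in> Ob \<C>" and d: "\<delta> \<in> ext \<C> T A"
  note B' = perp1D[OF B]
  have "\<delta> = push \<C> T r (push \<C> T s \<delta>)"
    unfolding push_Comp[OF t(2) A B'(1) A s r d, symmetric] rs using push_Id t A d by simp
  also have "push \<C> T s \<delta> = \<zero>\<^bsub>Ext \<C> T B\<^esub>" using B'(2) push_closed t A B'(1) s d by blast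
  finally show "\<delta> = \<zero>\<^bsub>Ext \<C> T A\<^esub>" using push_zero t A B'(1) r by simp
qed

lemma perp1_realization:
  assumes "\<T> \<subseteq> Ob \<C>" "realizes \<C> \<delta> A x B y C" "realizes \<C> \<delta> A x' B' y' C"
    and "B \<in> perp1 \<C> \<T>"
  shows "B' \<in> perp1 \<C> \<T>"
proof -
  obtain f g where "f \<in> mor \<C> B B'" "g \<in> mor \<C> B' B" "f \<cdot> g = Id \<C> B'"
    using realizations_isomorphic[OF assms(2,3)] .
  then show ?thesis using perp1_retract[OF assms(1,4) realizesD(2)[OF assms(3)]] by blast
qed

lemma subcategory_realization:
  assumes "subcategory \<C> \<T>" "realizes \<C> \<delta> A x B y C" "realizes \<C> \<delta> A x' B' y' C"
    and "B \<in> \<T>"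
  shows "B' \<in> \<T>"
proof -
  obtain f g where "f \<in> mor \<C> B B'" "g \<in> mor \<C> B' B" "g \<cdot> f = Id \<C> B" "f \<cdot> g = Id \<C> B'"
    using realizations_isomorphic[OF assms(2,3)] .
  then have "isomorphic \<C> B B'" unfolding isomorphic_def isomorphism_def by blast
  then show ?thesis using assms(1,4) realizesD(2)[OF assms(3)] unfolding subcategory_def by blast
qed

lemma perp1_injective: "\<lbrakk>\<T> \<subseteq> Ob \<C>; injective \<C> I\<rbrakk> \<Longrightarrow> I \<in> perp1 \<C> \<T>"
  using perp1I ext_injective_zero unfolding injective_def by blast

lemma perp1_extension:
  assumes T: "\<T> \<subseteq> Ob \<C>" and con: "conflation \<C> A x B y C"
    and A: "A \<in> perp1 \<C> \<T>" and C: "C \<in> perp1 \<C> \<T>"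
  shows "B \<in> perp1 \<C> \<T>"
proof -
  obtain \<delta> where r: "realizes \<C> \<delta> A x B y C" using con by (auto simp: conflation_def)
  note D = realizesD[OF r]
  show ?thesis
  proof (rule perp1I[OF T D(2)])
    fix T \<beta> assume t: "T \<in> \<T>" "T \<in> Ob \<C>" and b: "\<beta> \<in> ext \<C> T B"
    have "push \<C> T y \<beta> = \<zero>\<^bsub>Ext \<C> T C\<^esub>"
      using perp1D(2)[OF C t(1)] push_closed t D b by blast
    then obtain \<alpha> where a: "\<alpha> \<in> ext \<C> T A" "push \<C> T x \<alpha> = \<beta>"
      using push_kernel[OF r t(2) b] by blast
    then have "\<alpha> = \<zero>\<^bsub>Ext \<C> T A\<^esub>" using perp1D(2)[OF A t(1)] by blast
    then show "\<beta> = \<zero>\<^bsub>Ext \<C> T B\<^esub>" using a push_zero t D by blast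
  qed
qed

text \<open>
  For \<open>T \<in> \<T>\<close> with presentation \<open>P\<^sub>1 \<rightarrow> P\<^sub>0 \<rightarrow> T\<close>, every element of \<open>\<E>(T, C)\<close> is the pushforward of the
  presentation along some \<open>f : P\<^sub>1 \<rightarrow> C\<close>, since \<open>P\<^sub>0\<close> is projective. As \<open>P\<^sub>1\<close> is projective, \<open>f\<close> factors
  through \<open>B\<close>, and therefore the element factors through \<open>\<E>(T, B) = 0\<close>.
\<close>

lemma perp1_quotient:
  assumes T: "\<T> \<subseteq> Ob \<C>" and pd: "pd_sub \<C> \<T> \<le> 1" and con: "conflation \<C> A x B y C"
    and B: "B \<in> perp1 \<C> \<T>"
  shows "C \<in> perp1 \<C> \<T>"
proof -
  obtain \<delta> where r: "realizes \<C> \<delta> A x B y C" using con by (auto simp: conflation_def)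
  note D = realizesD[OF r]
  have y: "deflation \<C> B C y" using con by (auto simp: deflation_def)
  show ?thesis
  proof (rule perp1I[OF T D(3)])
    fix T \<gamma> assume t: "T \<in> \<T>" "T \<in> Ob \<C>" and c: "\<gamma> \<in> ext \<C> T C"
    have "pd \<C> T \<le> 1" using pd t unfolding pd_sub_def by (meson SUP_le_iff)
    then obtain P\<^sub>0 P\<^sub>1 u v where P: "projective \<C> P\<^sub>0" "projective \<C> P\<^sub>1"
      and "conflation \<C> P\<^sub>1 u P\<^sub>0 v T"
      by (rule projective_presentation)
    then obtain \<epsilon> where e: "realizes \<C> \<epsilon> P\<^sub>1 u P\<^sub>0 v T" by (auto simp: conflation_def)
    note E = realizesD[OF e]
    obtain u' G v' where g: "realizes \<C> \<gamma> C u' G v' T" using realizable[OF t(2) D(3) c] .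
    note G = realizesD[OF g]
    have "deflation \<C> G T v'" using g by (auto simp: deflation_def conflation_def)
    then obtain b where b: "b \<in> mor \<C> P\<^sub>0 G" "v' \<cdot> b = v"
      using P E unfolding projective_def by blast
    then have "Id \<C> T \<cdot> v = v' \<cdot> b" using Comp_Id_left E by simp
    then obtain f where "ext_morphism \<C> T P\<^sub>1 \<epsilon> T C \<gamma> f (Id \<C> T)"
      using ET3_op[OF e g b(1) Id_closed[OF t(2)]] by blast
    then have f: "f \<in> mor \<C> P\<^sub>1 C" "push \<C> T f \<epsilon> = \<gamma>"
      using pull_Id t D c unfolding ext_morphism_def by simp_all
    obtain k where k: "k \<in> mor \<C> P\<^sub>1 B" "y \<cdot> k = f"
      using P y f unfolding projective_def by blast
    have "push \<C> T k \<epsilon> = \<zero>\<^bsub>Ext \<C> T B\<^esub>"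
      using perp1D(2)[OF B t(1)] push_closed E D k by blast
    then show "\<gamma> = \<zero>\<^bsub>Ext \<C> T C\<^esub>"
      using push_Comp[OF t(2) E(1) D(2,3) k(1) D(5) E(6)] k f push_zero[OF t(2) D(2,3,5)] by simp
  qed
qed

section \<open>From generation to coresolutions of projectives\<close>

lemma projective_coresolution:
  assumes T: "subcategory \<C> \<T>" and pd: "pd_sub \<C> \<T> \<le> 1"
    and gen: "generator \<C> \<T> (perp1 \<C> \<T>)"
    and inj: "enough_injectives \<C>" and summ: "closed_under_summands \<C> \<T>"
    and P: "projective \<C> P"
  obtains T\<^sub>0 T\<^sub>1 x y where "T\<^sub>0 \<in> \<T>" "T\<^sub>1 \<in> \<T>" "conflation \<C> P x T\<^sub>0 y T\<^sub>1"
proof -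
  have TO: "\<T> \<subseteq> Ob \<C>" using T by (simp add: subcategory_def)
  obtain I i c C where I: "injective \<C> I" and "conflation \<C> P i I c C"
    using inj P unfolding enough_injectives_def projective_def inflation_def by blast
  then have C: "C \<in> perp1 \<C> \<T>" using perp1_quotient TO pd perp1_injective by blast
  obtain \<delta>\<^sub>1 where r\<^sub>1: "realizes \<C> \<delta>\<^sub>1 P i I c C"
    using \<open>conflation \<C> P i I c C\<close> by (auto simp: conflation_def)
  obtain V T\<^sub>C v t \<delta>\<^sub>2 where V: "V \<in> perp1 \<C> \<T>" "T\<^sub>C \<in> \<T>"
    and r\<^sub>2: "realizes \<C> \<delta>\<^sub>2 V v T\<^sub>C t C"
    using gen C unfolding generator_def conflation_def by blast
  \<comment> \<open>Up to isomorphism \<open>I' = I\<close> and \<open>T' = T\<^sub>C\<close>.\<close>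
  obtain M I' T' u\<^sub>1 v\<^sub>1 u\<^sub>2 v\<^sub>2 s\<^sub>1 t\<^sub>1 s\<^sub>2 t\<^sub>2 where
    M: "conflation \<C> V u\<^sub>2 M v\<^sub>2 I'" "conflation \<C> P u\<^sub>1 M v\<^sub>1 T'"
    and I'0: "realizes \<C> \<delta>\<^sub>1 P s\<^sub>1 I' t\<^sub>1 C" and T'0: "realizes \<C> \<delta>\<^sub>2 V s\<^sub>2 T' t\<^sub>2 C"
    using pullback_of_deflations[OF r\<^sub>1 r\<^sub>2] .
  have I': "I' \<in> perp1 \<C> \<T>" using perp1_realization[OF TO r\<^sub>1 I'0] perp1_injective TO I by blast
  have T': "T' \<in> \<T>" using subcategory_realization[OF T r\<^sub>2 T'0] V by blast
  have "M \<in> perp1 \<C> \<T>" using perp1_extension[OF TO M(1)] V I' by blast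
  then obtain V' T'' w z \<epsilon> where V': "V' \<in> perp1 \<C> \<T>" "T'' \<in> \<T>"
    and e: "realizes \<C> \<epsilon> V' w T'' z M"
    using gen unfolding generator_def conflation_def by blast
  obtain \<mu> where \<mu>: "realizes \<C> \<mu> P u\<^sub>1 M v\<^sub>1 T'" using M by (auto simp: conflation_def)
  note E = realizesD[OF e] and U = realizesD[OF \<mu>]
  \<comment> \<open>\<open>\<E>(M, V')\<close> lies between \<open>\<E>(T', V') = 0\<close> and \<open>\<E>(P, V') = 0\<close>.\<close>
  have "pull \<C> V' u\<^sub>1 \<epsilon> = \<zero>\<^bsub>Ext \<C> P V'\<^esub>"
    using ext_projective_zero[OF P] pull_closed E U by blast
  then obtain \<gamma> where g: "\<gamma> \<in> ext \<C> T' V'" "pull \<C> V' v\<^sub>1 \<gamma> = \<epsilon>"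
    using pull_kernel[OF \<mu> E(1,6)] by blast
  have "\<gamma> = \<zero>\<^bsub>Ext \<C> T' V'\<^esub>" using perp1D(2)[OF V'(1) T'] g by blast
  then have "\<epsilon> = \<zero>\<^bsub>Ext \<C> M V'\<^esub>" using g pull_zero E U by blast
  then obtain j p where "biproduct \<C> V' M T'' w j p z"
    using zero_extension_biproduct e by blast
  then have "M \<in> \<T>" using summ V' unfolding closed_under_summands_def by blast
  then show thesis using that T' M by blast
qed

section \<open>From coresolutions of projectives to generation\<close>

lemma closed_under_finite_sums_biproduct:
  assumes "closed_under_finite_sums \<C> \<T>" "biproduct \<C> A B S i\<^sub>A i\<^sub>B p\<^sub>A p\<^sub>B" "A \<in> \<T>" "B \<in> \<T>"
  shows "S \<in> \<T>"
proof -
  have "\<forall>k<2::nat. (if k = 0 then A else B) \<in> \<T>" using assms by simp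
  then show ?thesis
    using assms(1) biproduct_direct_sum[OF assms(2)] unfolding closed_under_finite_sums_def by blast
qed

lemma self_orthogonal_perp1:
  assumes "\<T> \<subseteq> Ob \<C>" "\<forall>T \<in> \<T>. \<forall>T' \<in> \<T>. ext \<C> T T' = {\<zero>\<^bsub>Ext \<C> T T'\<^esub>}"
  shows "\<T> \<subseteq> perp1 \<C> \<T>"
  using assms unfolding perp1_def by blast

lemma perp1_generated:
  assumes T: "subcategory \<C> \<T>" and pd: "pd_sub \<C> \<T> \<le> 1"
    and orth: "\<forall>T \<in> \<T>. \<forall>T' \<in> \<T>. ext \<C> T T' = {\<zero>\<^bsub>Ext \<C> T T'\<^esub>}"
    and cores: "\<And>P. projective \<C> P \<Longrightarrow> \<exists>T\<^sub>0 \<in> \<T>. \<exists>T\<^sub>1 \<in> \<T>. \<exists>x y. conflation \<C> P x T\<^sub>0 y T\<^sub>1"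
    and proj: "enough_projectives \<C>" and sums: "closed_under_finite_sums \<C> \<T>"
    and V: "V \<in> perp1 \<C> \<T>"
  obtains W T x y where "W \<in> perp1 \<C> \<T>" "T \<in> \<T>" "conflation \<C> W x T y V"
proof -
  have TO: "\<T> \<subseteq> Ob \<C>" using T by (simp add: subcategory_def)
  have perp: "X \<in> perp1 \<C> \<T>" if "X \<in> \<T>" for X using self_orthogonal_perp1[OF TO orth] that by blast
  have cover: "\<exists>P K \<delta> T\<^sub>0 T\<^sub>1 k p \<delta>' f f'. T\<^sub>0 \<in> \<T> \<and> T\<^sub>1 \<in> \<T> \<and>
      realizes \<C> \<delta> K k P p X \<and> realizes \<C> \<delta>' P f T\<^sub>0 f' T\<^sub>1" if "X \<in> Ob \<C>" for X
    using proj cores that unfolding enough_projectives_def deflation_def conflation_def by meson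
  obtain P K \<delta> T\<^sub>0 T\<^sub>1 k p \<delta>' f f' where T01: "T\<^sub>0 \<in> \<T>" "T\<^sub>1 \<in> \<T>"
    and r: "realizes \<C> \<delta> K k P p V" and r': "realizes \<C> \<delta>' P f T\<^sub>0 f' T\<^sub>1"
    using cover[OF perp1D(1)[OF V]] by blast
  note R = realizesD[OF r] and R' = realizesD[OF r']
  obtain E h h' d e \<delta>'' where E\<^sub>1: "realizes \<C> \<delta>'' K h T\<^sub>0 h' E"
    and E\<^sub>2: "realizes \<C> (push \<C> T\<^sub>1 p \<delta>') V d E e T\<^sub>1"
    using ET4[OF r r'] by blast
  have "push \<C> T\<^sub>1 p \<delta>' = \<zero>\<^bsub>Ext \<C> T\<^sub>1 V\<^esub>"
    using perp1D(2)[OF V T01(2)] push_closed R R' by blast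
  then obtain j q where bp: "biproduct \<C> V T\<^sub>1 E d j q e"
    using zero_extension_biproduct E\<^sub>2 by metis
  \<comment> \<open>Exchanging the summands turns \<open>V \<rightarrow> E \<rightarrow> T\<^sub>1\<close> around: \<open>E \<rightarrow> V\<close> is a deflation with kernel \<open>T\<^sub>1\<close>.\<close>
  have split: "realizes \<C> \<zero>\<^bsub>Ext \<C> V T\<^sub>1\<^esub> T\<^sub>1 j E q V"
    using Real_zero[OF biproduct_commute[OF bp]] .
  obtain P' K' \<epsilon> T\<^sub>0' T\<^sub>1' k' p' \<epsilon>' g g' where T01': "T\<^sub>0' \<in> \<T>" "T\<^sub>1' \<in> \<T>"
    and s: "realizes \<C> \<epsilon> K' k' P' p' K" and s': "realizes \<C> \<epsilon>' P' g T\<^sub>0' g' T\<^sub>1'"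
    using cover[OF R(1)] by blast
  obtain L l l' a b \<epsilon>'' where L\<^sub>1: "realizes \<C> \<epsilon>'' K' l T\<^sub>0' l' L"
    and L\<^sub>2: "realizes \<C> (push \<C> T\<^sub>1' p' \<epsilon>') K a L b T\<^sub>1'"
    using ET4[OF s s'] by blast
  have L: "L \<in> perp1 \<C> \<T>"
    using perp1_quotient[OF TO pd _ perp[OF T01'(1)]] L\<^sub>1 unfolding conflation_def by blast
  \<comment> \<open>Up to isomorphism \<open>X = T\<^sub>0\<close> and \<open>L' = L\<close>.\<close>
  obtain M X L' u\<^sub>1 v\<^sub>1 u\<^sub>2 v\<^sub>2 s\<^sub>1 t\<^sub>1 s\<^sub>2 t\<^sub>2 where
    M: "conflation \<C> L' u\<^sub>2 M v\<^sub>2 E" "conflation \<C> X u\<^sub>1 M v\<^sub>1 T\<^sub>1'"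
    and X0: "realizes \<C> \<delta>'' K s\<^sub>1 X t\<^sub>1 E"
    and L'0: "realizes \<C> (push \<C> T\<^sub>1' p' \<epsilon>') K s\<^sub>2 L' t\<^sub>2 T\<^sub>1'"
    using pushout_of_inflations[OF E\<^sub>1 L\<^sub>2] .
  have X: "X \<in> \<T>" using subcategory_realization[OF T E\<^sub>1 X0 T01(1)] .
  have L': "L' \<in> perp1 \<C> \<T>" using perp1_realization[OF TO L\<^sub>2 L'0 L] .
  obtain \<mu> where \<mu>: "realizes \<C> \<mu> X u\<^sub>1 M v\<^sub>1 T\<^sub>1'" using M by (auto simp: conflation_def)
  have "\<mu> = \<zero>\<^bsub>Ext \<C> T\<^sub>1' X\<^esub>" using perp1D(2)[OF perp[OF X] T01'(2)] realizesD(6)[OF \<mu>] .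
  then obtain i q' where "biproduct \<C> X T\<^sub>1' M u\<^sub>1 i q' v\<^sub>1"
    using zero_extension_biproduct \<mu> by blast
  then have MT: "M \<in> \<T>" using closed_under_finite_sums_biproduct[OF sums] X T01' by blast
  obtain \<nu> where \<nu>: "realizes \<C> \<nu> L' u\<^sub>2 M v\<^sub>2 E" using M by (auto simp: conflation_def)
  obtain W m m' a' b' \<omega> where W: "realizes \<C> \<omega> W m' M m V"
    "realizes \<C> (pull \<C> L' j \<nu>) L' b' W a' T\<^sub>1"
    using ET4_op[OF split \<nu>] by blast
  have "W \<in> perp1 \<C> \<T>"
    using perp1_extension[OF TO _ L' perp[OF T01(2)]] W(2) unfolding conflation_def by blast
  then show thesis using that MT W(1) unfolding conflation_def by blast
qed

end

section \<open>Equivalence of the two definitions\<close>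

theorem theorem3p3:
  fixes \<C> :: "('o, 'm, 'e, 'z) extri_scheme"
    and \<T> :: "'o set"
  assumes "extriangulated_category \<C>"
    and "skeletally_small \<C>"
    and "krull_schmidt \<C>"
    and "enough_projectives \<C>"
    and "enough_injectives \<C>"
    and "WIC \<C>"
    and "subcategory \<C> \<T>"
    and "closed_under_summands \<C> \<T>"
    and "closed_under_finite_sums \<C> \<T>"
  shows "tilting_A \<C> \<T> \<longleftrightarrow> tilting_B \<C> \<T>"
proof -
  interpret extriangulated_category \<C> by (rule assms(1))
  have TO: "\<T> \<subseteq> Ob \<C>" using assms(7) by (simp add: subcategory_def)
  show ?thesis
  proof
    assume A: "tilting_A \<C> \<T>"
    then have pd: "pd_sub \<C> \<T> \<le> 1" and gen: "generator \<C> \<T> (perp1 \<C> \<T>)"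
      by (auto simp: tilting_A_def)
    have "\<forall>T \<in> \<T>. \<forall>T' \<in> \<T>. ext \<C> T T' = {\<zero>\<^bsub>Ext \<C> T T'\<^esub>}"
      using gen unfolding generator_def perp1_def by blast
    moreover have "\<exists>T\<^sub>0 \<in> \<T>. \<exists>T\<^sub>1 \<in> \<T>. \<exists>x y. conflation \<C> P x T\<^sub>0 y T\<^sub>1" if "projective \<C> P" for P
      using projective_coresolution[OF assms(7) pd gen assms(5,8) that] by metis
    ultimately show "tilting_B \<C> \<T>" using pd unfolding tilting_B_def by blast
  next
    assume B: "tilting_B \<C> \<T>"
    then have pd: "pd_sub \<C> \<T> \<le> 1"
      and orth: "\<forall>T \<in> \<T>. \<forall>T' \<in> \<T>. ext \<C> T T' = {\<zero>\<^bsub>Ext \<C> T T'\<^esub>}"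
      and cores: "projective \<C> P \<Longrightarrow> \<exists>T\<^sub>0 \<in> \<T>. \<exists>T\<^sub>1 \<in> \<T>. \<exists>x y. conflation \<C> P x T\<^sub>0 y T\<^sub>1" for P
      unfolding tilting_B_def by blast+
    have "\<exists>V' \<in> perp1 \<C> \<T>. \<exists>U \<in> \<T>. \<exists>x y. conflation \<C> V' x U y V" if "V \<in> perp1 \<C> \<T>" for V
      using perp1_generated[OF assms(7) pd orth cores assms(4,9) that] by metis
    then show "tilting_A \<C> \<T>"
      using pd self_orthogonal_perp1[OF TO orth] unfolding tilting_A_def generator_def by blast
  qed
qed

end
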